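(* Let $G$ be a compact group, let $\Psi$ be a list of frequencies, and let $\lambda\ge0$. Suppose the random vector $Z^{(G,\Psi)}$ is sub-Gaussian with covariance proxy $\sigma^2I$ (with $\sigma>0$). If $\lambda<1/\sigma$, then $\mathrm{GSynch}_n(\lambda,G,\Psi)$ is contiguous to $\mathrm{GSynch}_n(0,G,\Psi)$.
   Context: Representations. Every irreducible complex representation $\rho$ of a compact group $G$ is finite dimensional, may be taken unitary, and has real, complex, or quaternionic type. Real-type representations are taken to be defined by unitary matrices over $\mathbb{R}$, complex-type over $\mathbb{C}$, and quaternionic-type over the quaternions $\mathbb{H}$ (via the standard embedding of $\mathbb{H}$ into $2\times2$ complex matrices). $d_\rho$ is the dimension of $\rho$ over $\mathbb{R},\mathbb{C},\mathbb{H}$ respectively (so for quaternionic type $d_\rho$ is half the complex dimension), and $\beta_\rho=1,2,4$ respectively. A list of frequencies $\Psi$ is a finite set of pairwise non-isomorphic irreducible (over $\mathbb{C}$) representations of $G$, not containing the trivial representation, and not containing both $\rho$ and its conjugate $\bar\rho$ for any complex-type $\rho$. Noise. A standard Gaussian of real, complex, quaternionic type is $\mathcal{N}(0,1)$; $\mathcal{N}(0,\frac12)+\mathcal{N}(0,\frac12)i$; $\mathcal{N}(0,\frac14)+\mathcal{N}(0,\frac14)i+\mathcal{N}(0,\frac14)j+\mathcal{N}(0,\frac14)k$, respectively, with independent components. A GOE, GUE, GSE matrix is a random Hermitian matrix over $\mathbb{R},\mathbb{C},\mathbb{H}$ respectively, with off-diagonal entries standard Gaussians of the corresponding type and diagonal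 entries real $\mathcal{N}(0,2/\beta)$, $\beta=1,2,4$ respectively, independent except for the Hermitian constraint. Model. $\mathrm{GSynch}_n(\{\lambda_\rho\},G,\Psi)$, with $\lambda_\rho\ge0$ for $\rho\in\Psi$: draw $g\in G^n$ with independent Haar-distributed coordinates. Let $X_\rho$ be the $nd_\rho\times d_\rho$ matrix obtained by stacking the matrices $\rho(g_u)$, $u=1,\dots,n$. For each $\rho\in\Psi$ reveal the $nd_\rho\times nd_\rho$ matrix $Y_\rho=\frac{\lambda_\rho}nX_\rho X_\rho^*+\frac1{\sqrt{nd_\rho}}W_\rho$, where $W_\rho$ is a GOE, GUE or GSE matrix according to the type of $\rho$; the $W_\rho$ are independent across $\rho$ and independent of $g$. The model is the joint law of $\{Y_\rho\}_{\rho\in\Psi}$. A scalar $\lambda$ in place of $\{\lambda_\rho\}$ means $\lambda_\rho=\lambda$ for all $\rho$. The random vector $Z^{(G,\Psi)}\in\mathbb{R}^D$, $D=\sum_{\rho\in\Psi}\beta_\rho d_\rho^2$: draw $h$ from Haar measure on $G$; for each $\rho\in\Psi$ vectorize the matrix $\sqrt{\beta_\rho d_\rho}\,\rho(h)$ into a real vector of length $\beta_\rho d_\rho^2$ by separating the $\beta_\rho$ real components of each of its $d_\rho^2$ entries; concatenate these vectors over $\rho\in\Psi$. A random vector $z\in\mathbb{R}^m$ is sub-Gaussian with covariance proxy $\sigma^2I$ if $\mathbb{E}[z]=0$ and $\mathbb{E}\exp(\langle z,v\rangle)\le\exp(\frac12\sigma^2\|v\|^2)$ for all $v\in\mathbb{R}^m$.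 Contiguity: for sequences of probability measures $P_n,Q_n$ on measurable spaces $(\Omega_n,\mathcal{F}_n)$, $P_n$ is contiguous to $Q_n$ if for every sequence of events $A_n\in\mathcal{F}_n$, $Q_n(A_n)\to0$ implies $P_n(A_n)\to0$ as $n\to\infty$. *)

theory Defs
  imports "HOL-Probability.Probability" "Jordan_Normal_Form.VS_Connect"
begin

section \<open>Quaternions\<close>

datatype quat = Quat (qre: real) (qi: real) (qj: real) (qk: real)

instantiation quat :: real_algebra_1
begin

definition "0 = Quat 0 0 0 0"
definition "1 = Quat 1 0 0 0"
definition "p + q = Quat (qre p + qre q) (qi p + qi q) (qj p + qj q) (qk p + qk q)"
definition "- q = Quat (- qre q) (- qi q) (- qj q) (- qk q)"
definition "p - q = Quat (qre p - qre q) (qi p - qi q) (qj p - qj q) (qk p - qk q)"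
definition "r *\<^sub>R q = Quat (r * qre q) (r * qi q) (r * qj q) (r * qk q)"
definition "p * q = Quat
  (qre p * qre q - qi p * qi q - qj p * qj q - qk p * qk q)
  (qre p * qi q + qi p * qre q + qj p * qk q - qk p * qj q)
  (qre p * qj q - qi p * qk q + qj p * qre q + qk p * qi q)
  (qre p * qk q + qi p * qj q - qj p * qi q + qk p * qre q)"

instance
  by standard
    (simp_all add: zero_quat_def one_quat_def plus_quat_def uminus_quat_def minus_quat_def
      scaleR_quat_def times_quat_def algebra_simps)

end

text \<open>The real components of a quaternion, in the order \<open>1, i, j, k\<close>.\<close>

definition qcomp :: "nat \<Rightarrow> quat \<Rightarrow> real" where
  "qcomp c q = (if c = 0 then qre q else if c = 1 then qi q else if c = 2 then qj q
     else if c = 3 then qk q else 0)"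

definition qcnj :: "quat \<Rightarrow> quat" where
  "qcnj q = Quat (qre q) (- qi q) (- qj q) (- qk q)"

definition qadjoint :: "quat mat \<Rightarrow> quat mat" where
  "qadjoint A = transpose_mat (map_mat qcnj A)"

section \<open>The three types\<close>

text \<open>
  Matrices over \<open>\<real>\<close>, \<open>\<complex>\<close> and \<open>\<H>\<close> are all
  represented as matrices over \<open>quat\<close>, where \<open>\<real>\<close> is the subalgebra of
  quaternions \<open>a\<close> and \<open>\<complex>\<close> the subalgebra of quaternions \<open>a + b i\<close>: the
  subalgebra of type \<open>t\<close> consists of the quaternions whose components from number \<open>rbeta t\<close>
  onwards vanish.
\<close>

datatype rtype = Real_type | Complex_type | Quaternionic_type

fun rbeta :: "rtype \<Rightarrow> nat" where
  "rbeta Real_type = 1"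
| "rbeta Complex_type = 2"
| "rbeta Quaternionic_type = 4"

definition type_algebra :: "rtype \<Rightarrow> quat set" where
  "type_algebra t = {q. \<forall>c\<ge>rbeta t. qcomp c q = 0}"

text \<open>
  The complex matrix of a matrix over \<open>type_algebra t\<close>. In the quaternionic case each entry
  \<open>z + w j\<close> (\<open>z\<close>, \<open>w\<close> complex) is replaced by the block with rows
  \<open>(z, w)\<close> and \<open>(- cnj w, cnj z)\<close>.
\<close>

definition quat_block :: "quat \<Rightarrow> nat \<Rightarrow> nat \<Rightarrow> complex" where
  "quat_block q a b =
    (let z = Complex (qre q) (qi q); w = Complex (qj q) (qk q) in
     if a = 0 then (if b = 0 then z else w) else (if b = 0 then - cnj w else cnj z))"

fun complex_of_quat_mat :: "rtype \<Rightarrow> quat mat \<Rightarrow> complex mat" where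
  "complex_of_quat_mat Real_type A = map_mat (\<lambda>q. complex_of_real (qre q)) A"
| "complex_of_quat_mat Complex_type A = map_mat (\<lambda>q. Complex (qre q) (qi q)) A"
| "complex_of_quat_mat Quaternionic_type A =
    mat (2 * dim_row A) (2 * dim_col A)
      (\<lambda>(i, j). quat_block (A $$ (i div 2, j div 2)) (i mod 2) (j mod 2))"

section \<open>Compact groups and Haar measure\<close>

locale compact_group = group G for G (structure) +
  fixes T :: "'a topology"
  assumes topspace_eq: "topspace T = carrier G"
    and continuous_mult: "continuous_map (prod_topology T T) T (\<lambda>(x, y). x \<otimes> y)"
    and continuous_inv: "continuous_map T T (\<lambda>x. inv x)"
    and compact: "compact_space T"
    and Hausdorff: "Hausdorff_space T"

text \<open>
  Normalized Haar measure: the (unique) left-invariant regular Borel probability measure.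
  For a finite measure, inner regularity by compact sets gives outer regularity by open sets.
\<close>

definition haar_measure :: "('g, 'm) monoid_scheme \<Rightarrow> 'g topology \<Rightarrow> 'g measure \<Rightarrow> bool" where
  "haar_measure G T \<mu> \<longleftrightarrow>
     space \<mu> = topspace T \<and>
     sets \<mu> = sigma_sets (topspace T) {U. openin T U} \<and>
     prob_space \<mu> \<and>
     (\<forall>a\<in>carrier G. \<forall>A\<in>sets \<mu>. emeasure \<mu> ((\<lambda>x. a \<otimes>\<^bsub>G\<^esub> x) ` A) = emeasure \<mu> A) \<and>
     (\<forall>A\<in>sets \<mu>. emeasure \<mu> A = (SUP K\<in>{K. compactin T K \<and> K \<subseteq> A}. emeasure \<mu> K))"

section \<open>Representations and lists of frequencies\<close>

definition irreducible_rep :: "('g, 'm) monoid_scheme \<Rightarrow> nat \<Rightarrow> ('g \<Rightarrow> complex mat) \<Rightarrow> bool" where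
  "irreducible_rep G m \<sigma> \<longleftrightarrow> m > 0 \<and>
     (\<forall>W. VectorSpace.subspace class_ring W (module_vec TYPE(complex) m) \<and>
          (\<forall>g\<in>carrier G. \<forall>v\<in>W. \<sigma> g *\<^sub>v v \<in> W) \<longrightarrow>
          W = {0\<^sub>v m} \<or> W = carrier_vec m)"

definition isomorphic_reps ::
  "('g, 'm) monoid_scheme \<Rightarrow> nat \<Rightarrow> ('g \<Rightarrow> complex mat) \<Rightarrow> nat \<Rightarrow> ('g \<Rightarrow> complex mat) \<Rightarrow> bool" where
  "isomorphic_reps G m \<sigma> m' \<tau> \<longleftrightarrow> m = m' \<and>
     (\<exists>P\<in>carrier_mat m m. invertible_mat P \<and> (\<forall>g\<in>carrier G. P * \<sigma> g = \<tau> g * P))"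

text \<open>
  A representation is given by its type \<open>t\<close>, its dimension over the algebra of type \<open>t\<close>, and
  its matrices over that algebra.
\<close>

record 'g rep =
  rep_type :: rtype
  rep_dim :: nat
  rep_mat :: "'g \<Rightarrow> quat mat"

definition cdim :: "'g rep \<Rightarrow> nat" where
  "cdim \<rho> = (if rep_type \<rho> = Quaternionic_type then 2 * rep_dim \<rho> else rep_dim \<rho>)"

definition cmat :: "'g rep \<Rightarrow> 'g \<Rightarrow> complex mat" where
  "cmat \<rho> g = complex_of_quat_mat (rep_type \<rho>) (rep_mat \<rho> g)"

definition cmat_conj :: "'g rep \<Rightarrow> 'g \<Rightarrow> complex mat" where
  "cmat_conj \<rho> g = map_mat cnj (cmat \<rho> g)"

definition unitary_rep :: "('g, 'm) monoid_scheme \<Rightarrow> 'g topology \<Rightarrow> 'g rep \<Rightarrow> bool" where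
  "unitary_rep G T \<rho> \<longleftrightarrow>
     (let d = rep_dim \<rho> in
       (\<forall>g\<in>carrier G. rep_mat \<rho> g \<in> carrier_mat d d \<and>
          elements_mat (rep_mat \<rho> g) \<subseteq> type_algebra (rep_type \<rho>) \<and>
          rep_mat \<rho> g * qadjoint (rep_mat \<rho> g) = 1\<^sub>m d \<and>
          qadjoint (rep_mat \<rho> g) * rep_mat \<rho> g = 1\<^sub>m d) \<and>
       (\<forall>g\<in>carrier G. \<forall>h\<in>carrier G. rep_mat \<rho> (g \<otimes>\<^bsub>G\<^esub> h) = rep_mat \<rho> g * rep_mat \<rho> h) \<and>
       (\<forall>i<d. \<forall>j<d. \<forall>c<4.
          continuous_map T euclideanreal (\<lambda>g. qcomp c (rep_mat \<rho> g $$ (i, j)))))"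

text \<open>
  Complex type means not isomorphic to the conjugate representation. An irreducible representation
  defined over \<open>\<real>\<close> or \<open>\<H>\<close> has real or quaternionic type, respectively, so
  those cases need no further condition. Irreducibility is always over \<open>\<complex>\<close>.
\<close>

definition irrep :: "('g, 'm) monoid_scheme \<Rightarrow> 'g topology \<Rightarrow> 'g rep \<Rightarrow> bool" where
  "irrep G T \<rho> \<longleftrightarrow> unitary_rep G T \<rho> \<and> irreducible_rep G (cdim \<rho>) (cmat \<rho>) \<and>
     (rep_type \<rho> = Complex_type \<longrightarrow>
        \<not> isomorphic_reps G (cdim \<rho>) (cmat \<rho>) (cdim \<rho>) (cmat_conj \<rho>))"

text \<open>
  Containment of the trivial and of the conjugate representations is up to isomorphism. The last
  conjunct is implied by the definition of complex type when \<open>\<rho> = \<tau>\<close>.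
\<close>

definition frequency_list :: "('g, 'm) monoid_scheme \<Rightarrow> 'g topology \<Rightarrow> 'g rep set \<Rightarrow> bool" where
  "frequency_list G T \<Psi> \<longleftrightarrow> finite \<Psi> \<and>
     (\<forall>\<rho>\<in>\<Psi>. irrep G T \<rho>) \<and>
     (\<forall>\<rho>\<in>\<Psi>. \<not> isomorphic_reps G (cdim \<rho>) (cmat \<rho>) 1 (\<lambda>_. 1\<^sub>m 1)) \<and>
     (\<forall>\<rho>\<in>\<Psi>. \<forall>\<tau>\<in>\<Psi>. \<rho> \<noteq> \<tau> \<longrightarrow> \<not> isomorphic_reps G (cdim \<rho>) (cmat \<rho>) (cdim \<tau>) (cmat \<tau>)) \<and>
     (\<forall>\<rho>\<in>\<Psi>. \<forall>\<tau>\<in>\<Psi>. rep_type \<rho> = Complex_type \<longrightarrow>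
        \<not> isomorphic_reps G (cdim \<tau>) (cmat \<tau>) (cdim \<rho>) (cmat_conj \<rho>))"

section \<open>Gaussian ensembles\<close>

text \<open>The space of \<open>N \<times> N\<close> matrices, with the Borel sets of their real components.\<close>

definition mat_space :: "nat \<Rightarrow> quat mat measure" where
  "mat_space N = vimage_algebra (carrier_mat N N)
     (\<lambda>A. \<lambda>(i, j, c)\<in>{..<N} \<times> {..<N} \<times> {..<4}. qcomp c (A $$ (i, j)))
     (PiM ({..<N} \<times> {..<N} \<times> {..<4}) (\<lambda>_. borel))"

definition gauss :: "real \<Rightarrow> real measure" where
  "gauss v = density lborel (normal_density 0 (sqrt v))"

text \<open>
  The independent real components of a Hermitian matrix: the components \<open>c\<close> of the entries
  \<open>(i, j)\<close> above the diagonal, each of variance \<open>1 / \<beta>\<close>, and the real diagonal entries, of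
  variance \<open>2 / \<beta>\<close>.
\<close>

definition ensemble_index :: "rtype \<Rightarrow> nat \<Rightarrow> (nat \<times> nat \<times> nat) set" where
  "ensemble_index t N = {(i, j, c). i \<le> j \<and> j < N \<and> c < rbeta t \<and> (i = j \<longrightarrow> c = 0)}"

definition ensemble_components :: "rtype \<Rightarrow> nat \<Rightarrow> (nat \<times> nat \<times> nat \<Rightarrow> real) measure" where
  "ensemble_components t N = PiM (ensemble_index t N)
     (\<lambda>(i, j, c). gauss (if i = j then 2 / real (rbeta t) else 1 / real (rbeta t)))"

definition hermitian_mat :: "rtype \<Rightarrow> nat \<Rightarrow> (nat \<times> nat \<times> nat \<Rightarrow> real) \<Rightarrow> quat mat" where
  "hermitian_mat t N \<xi> =
    (let x = (\<lambda>i j c. if (i, j, c) \<in> ensemble_index t N then \<xi> (i, j, c) else 0);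
         q = (\<lambda>i j. Quat (x i j 0) (x i j 1) (x i j 2) (x i j 3))
     in mat N N (\<lambda>(i, j). if i \<le> j then q i j else qcnj (q j i)))"

text \<open>The law of a GOE, GUE or GSE matrix, according to the type.\<close>

definition gaussian_ensemble :: "rtype \<Rightarrow> nat \<Rightarrow> quat mat measure" where
  "gaussian_ensemble t N = distr (ensemble_components t N) (mat_space N) (hermitian_mat t N)"

section \<open>The synchronization model\<close>

definition stacked :: "nat \<Rightarrow> 'g rep \<Rightarrow> (nat \<Rightarrow> 'g) \<Rightarrow> quat mat" where
  "stacked n \<rho> g = (let d = rep_dim \<rho> in
     mat (n * d) d (\<lambda>(i, j). rep_mat \<rho> (g (i div d)) $$ (i mod d, j)))"

definition observation :: "nat \<Rightarrow> real \<Rightarrow> 'g rep \<Rightarrow> (nat \<Rightarrow> 'g) \<Rightarrow> quat mat \<Rightarrow> quat mat" where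
  "observation n l \<rho> g W =
     of_real (l / real n) \<cdot>\<^sub>m (stacked n \<rho> g * qadjoint (stacked n \<rho> g)) +
     of_real (1 / sqrt (real (n * rep_dim \<rho>))) \<cdot>\<^sub>m W"

definition GSynch ::
  "nat \<Rightarrow> ('g rep \<Rightarrow> real) \<Rightarrow> 'g measure \<Rightarrow> 'g rep set \<Rightarrow> ('g rep \<Rightarrow> quat mat) measure" where
  "GSynch n lam \<mu> \<Psi> =
     distr (PiM {..<n} (\<lambda>_. \<mu>) \<Otimes>\<^sub>M
            PiM \<Psi> (\<lambda>\<rho>. gaussian_ensemble (rep_type \<rho>) (n * rep_dim \<rho>)))
       (PiM \<Psi> (\<lambda>\<rho>. mat_space (n * rep_dim \<rho>)))
       (\<lambda>(g, W). \<lambda>\<rho>\<in>\<Psi>. observation n (lam \<rho>) \<rho> g (W \<rho>))"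

section \<open>Sub-Gaussian vectors and contiguity\<close>

text \<open>
  The vector \<open>Z\<close>, with coordinates indexed by the \<open>D\<close>-element set of all
  \<open>(\<rho>, i, j, c)\<close>, \<open>c\<close> numbering the real components of entry \<open>(i, j)\<close>, instead of \<open>1, \<dots>, D\<close>.
\<close>

definition Z_index :: "'g rep set \<Rightarrow> ('g rep \<times> nat \<times> nat \<times> nat) set" where
  "Z_index \<Psi> = (SIGMA \<rho>:\<Psi>. {..<rep_dim \<rho>} \<times> {..<rep_dim \<rho>} \<times> {..<rbeta (rep_type \<rho>)})"

definition Z_vec :: "'g \<Rightarrow> 'g rep \<times> nat \<times> nat \<times> nat \<Rightarrow> real" where
  "Z_vec h = (\<lambda>(\<rho>, i, j, c).
     sqrt (real (rbeta (rep_type \<rho>) * rep_dim \<rho>)) * qcomp c (rep_mat \<rho> h $$ (i, j)))"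

text \<open>
  Covariance proxy \<open>s I\<close>. The extended integral makes finiteness of the exponential moments part
  of the condition.
\<close>

definition sub_gaussian :: "'a measure \<Rightarrow> 'i set \<Rightarrow> ('a \<Rightarrow> 'i \<Rightarrow> real) \<Rightarrow> real \<Rightarrow> bool" where
  "sub_gaussian M I z s \<longleftrightarrow>
     (\<forall>i\<in>I. integrable M (\<lambda>x. z x i) \<and> (\<integral>x. z x i \<partial>M) = 0) \<and>
     (\<forall>v. (\<integral>\<^sup>+x. ennreal (exp (\<Sum>i\<in>I. z x i * v i)) \<partial>M)
            \<le> ennreal (exp (1/2 * s * (\<Sum>i\<in>I. (v i)\<^sup>2))))"

definition contiguous :: "(nat \<Rightarrow> 'a measure) \<Rightarrow> (nat \<Rightarrow> 'a measure) \<Rightarrow> bool" where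
  "contiguous P Q \<longleftrightarrow>
     (\<forall>n. prob_space (P n) \<and> prob_space (Q n) \<and> space (P n) = space (Q n) \<and> sets (P n) = sets (Q n)) \<and>
     (\<forall>A. (\<forall>n. A n \<in> sets (Q n)) \<longrightarrow> (\<lambda>n. measure (Q n) (A n)) \<longlonglongrightarrow> 0 \<longrightarrow>
          (\<lambda>n. measure (P n) (A n)) \<longlonglongrightarrow> 0)"

end

theory Submission
  imports Defs
begin

text \<open>
  Conditionally on the group elements \<open>g\<close>, the observation is a Gaussian vector with mean given by
  \<open>X X\<^sup>*\<close>, so the second moment of the likelihood ratio is the expectation over independent
  \<open>g\<close>, \<open>g'\<close> of the exponential of
  \<open>\<Sum>\<^sub>\<rho> \<lambda>\<^sup>2 \<beta> d / (2 n) \<parallel>X\<^sup>* X'\<parallel>\<^sup>2\<close>. The \<open>(k, l)\<close> entry of \<open>X\<^sup>* X'\<close> is the sum over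
  \<open>u\<close> of those of \<open>\<rho>(g\<^sub>u\<^sup>-\<^sup>1 g'\<^sub>u)\<close>, hence the exponent is
  \<open>\<lambda>\<^sup>2 / (2 n) \<parallel>\<Sum>\<^sub>u Z(g\<^sub>u\<^sup>-\<^sup>1 g'\<^sub>u)\<parallel>\<^sup>2\<close>. Writing \<open>exp (\<parallel>s\<parallel>\<^sup>2 / 2)\<close> as the expectation of
  \<open>exp \<langle>s, \<xi>\<rangle>\<close> for a standard Gaussian \<open>\<xi>\<close> and using left invariance and the sub-Gaussian bound for
  each \<open>u\<close>, the second moment is at most the expectation of
  \<open>exp (\<lambda>\<^sup>2 \<sigma>\<^sup>2 \<parallel>\<xi>\<parallel>\<^sup>2 / 2)\<close>, which is finite for \<open>\<lambda> \<sigma> < 1\<close> and independent of \<open>n\<close>.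
\<close>

section \<open>Product measures and Gaussian location families\<close>

text \<open>A measure on a finite product is determined by its values on boxes, and the preimage of
  a box under a coordinatewise map is again a box.\<close>

lemma PiM_distr:
  assumes "finite I" "\<And>i. i \<in> I \<Longrightarrow> prob_space (M i)"
    and "\<And>i. i \<in> I \<Longrightarrow> f i \<in> measurable (M i) (N i)"
  shows "distr (PiM I M) (PiM I N) (\<lambda>x. \<lambda>i\<in>I. f i (x i)) = PiM I (\<lambda>i. distr (M i) (N i) (f i))"
proof -
  \<comment> \<open>The product locales demand a probability measure at every index, while
    \<open>M\<close> is constrained only on \<open>I\<close>. A point mass serves as default
    elsewhere; products over \<open>I\<close> do not see it.\<close>
  let ?u = "return (count_space UNIV) undefined"
  define M' where "M' i = (if i \<in> I then M i else ?u)" for i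
  define D where "D i = (if i \<in> I then distr (M i) (N i) (f i) else ?u)" for i
  have u: "prob_space ?u" by (rule prob_space_return) simp
  have [simp]: "PiM I M' = PiM I M" "PiM I D = PiM I (\<lambda>i. distr (M i) (N i) (f i))"
    by (intro PiM_cong; simp add: M'_def D_def)+
  have "prob_space (M' i)" "prob_space (D i)" for i
    using assms u by (auto simp: M'_def D_def intro!: prob_space.prob_space_distr)
  then interpret M': product_prob_space M' + D: product_prob_space D
    by (auto simp: product_prob_space_def product_prob_space_axioms_def product_sigma_finite_def
        prob_space_imp_sigma_finite)
  have meas: "(\<lambda>x. \<lambda>i\<in>I. f i (x i)) \<in> measurable (PiM I M) (PiM I N)"
    using assms(3) by (intro measurable_restrict) (auto intro: measurable_compose[OF measurable_component_singleton])
  have "distr (PiM I M) (PiM I N) (\<lambda>x. \<lambda>i\<in>I. f i (x i)) = PiM I D"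
  proof (rule D.PiM_eqI[OF assms(1)])
    show "sets (distr (PiM I M) (PiM I N) (\<lambda>x. \<lambda>i\<in>I. f i (x i))) = sets (PiM I D)"
      unfolding sets_distr by (rule sets_PiM_cong) (auto simp: D_def)
  next
    fix A assume A: "\<And>i. i \<in> I \<Longrightarrow> A i \<in> sets (D i)"
    then have A': "\<And>i. i \<in> I \<Longrightarrow> A i \<in> sets (N i)" by (simp add: D_def)
    have "emeasure (distr (PiM I M) (PiM I N) (\<lambda>x. \<lambda>i\<in>I. f i (x i))) (Pi\<^sub>E I A)
      = emeasure (PiM I M') ((\<lambda>x. \<lambda>i\<in>I. f i (x i)) -` (Pi\<^sub>E I A) \<inter> space (PiM I M))"
      using A' assms(1) by (subst emeasure_distr[OF meas]) (auto intro!: sets_PiM_I_finite)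
    also have "(\<lambda>x. \<lambda>i\<in>I. f i (x i)) -` (Pi\<^sub>E I A) \<inter> space (PiM I M) = Pi\<^sub>E I (\<lambda>i. f i -` A i \<inter> space (M i))"
      by (auto simp: space_PiM PiE_iff)
    also have "emeasure (PiM I M') \<dots> = (\<Prod>i\<in>I. emeasure (M' i) (f i -` A i \<inter> space (M i)))"
      using A' assms by (intro M'.emeasure_PiM) (auto simp: M'_def intro: measurable_sets)
    also have "\<dots> = (\<Prod>i\<in>I. emeasure (D i) (A i))"
      using A' assms(3) by (intro prod.cong refl) (auto simp: M'_def D_def emeasure_distr)
    finally show "emeasure (distr (PiM I M) (PiM I N) (\<lambda>x. \<lambda>i\<in>I. f i (x i))) (Pi\<^sub>E I A)
      = (\<Prod>i\<in>I. emeasure (D i) (A i))" .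
  qed
  then show ?thesis by simp
qed

text \<open>Again it is enough to compare boxes: the product density times the indicator of a box is
  a product of functions of one coordinate each, so its integral factorizes.\<close>

lemma PiM_density:
  fixes f :: "'i \<Rightarrow> 'a \<Rightarrow> ennreal"
  assumes "finite I" "\<And>i. i \<in> I \<Longrightarrow> prob_space (M i)"
    and "\<And>i. i \<in> I \<Longrightarrow> f i \<in> borel_measurable (M i)"
    and "\<And>i. i \<in> I \<Longrightarrow> prob_space (density (M i) (f i))"
  shows "PiM I (\<lambda>i. density (M i) (f i)) = density (PiM I M) (\<lambda>x. \<Prod>i\<in>I. f i (x i))"
proof -
  let ?u = "return (count_space UNIV) undefined"
  define M' where "M' i = (if i \<in> I then M i else ?u)" for i
  define D where "D i = (if i \<in> I then density (M i) (f i) else ?u)" for i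
  have u: "prob_space ?u" by (rule prob_space_return) simp
  have [simp]: "PiM I M' = PiM I M" "PiM I D = PiM I (\<lambda>i. density (M i) (f i))"
    by (intro PiM_cong; simp add: M'_def D_def)+
  have "prob_space (M' i)" "prob_space (D i)" for i
    using assms u by (auto simp: M'_def D_def)
  then interpret M': product_prob_space M' + D: product_prob_space D
    by (auto simp: product_prob_space_def product_prob_space_axioms_def product_sigma_finite_def
        prob_space_imp_sigma_finite)
  have meas: "(\<lambda>x. \<Prod>i\<in>I. f i (x i)) \<in> borel_measurable (PiM I M)"
    using assms(3) by (intro borel_measurable_prod_ennreal) (auto intro: measurable_compose[OF measurable_component_singleton])
  have "density (PiM I M) (\<lambda>x. \<Prod>i\<in>I. f i (x i)) = PiM I D"
  proof (rule D.PiM_eqI[OF assms(1)])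
    show "sets (density (PiM I M) (\<lambda>x. \<Prod>i\<in>I. f i (x i))) = sets (PiM I D)"
      unfolding sets_density by (rule sets_PiM_cong) (auto simp: D_def)
  next
    fix A assume A: "\<And>i. i \<in> I \<Longrightarrow> A i \<in> sets (D i)"
    then have A': "\<And>i. i \<in> I \<Longrightarrow> A i \<in> sets (M i)" by (simp add: D_def)
    have "emeasure (density (PiM I M) (\<lambda>x. \<Prod>i\<in>I. f i (x i))) (Pi\<^sub>E I A)
      = (\<integral>\<^sup>+x. (\<Prod>i\<in>I. f i (x i)) * indicator (Pi\<^sub>E I A) x \<partial>PiM I M)"
      using A' assms(1) by (subst emeasure_density[OF meas]) (auto intro!: sets_PiM_I_finite)
    also have "\<dots> = (\<integral>\<^sup>+x. (\<Prod>i\<in>I. f i (x i) * indicator (A i) (x i)) \<partial>PiM I M')"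
      unfolding \<open>PiM I M' = PiM I M\<close> using assms(1)
      by (intro nn_integral_cong) (auto simp: indicator_def prod.distrib space_PiM PiE_iff)
    also have "\<dots> = (\<Prod>i\<in>I. \<integral>\<^sup>+x. f i x * indicator (A i) x \<partial>M' i)"
      using A' assms by (intro M'.product_nn_integral_prod) (auto simp: M'_def)
    also have "\<dots> = (\<Prod>i\<in>I. emeasure (D i) (A i))"
      using A' assms(3) by (intro prod.cong refl) (auto simp: M'_def D_def emeasure_density)
    finally show "emeasure (density (PiM I M) (\<lambda>x. \<Prod>i\<in>I. f i (x i))) (Pi\<^sub>E I A)
      = (\<Prod>i\<in>I. emeasure (D i) (A i))" .
  qed
  then show ?thesis by simp
qed

section \<open>One-dimensional Gaussians: translation, exponential moments, exponential of a
  square\<close>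

lemma prob_space_gauss: "prob_space (gauss v)" if "v > 0"
  unfolding gauss_def using prob_space_normal_density[of "sqrt v" 0] that by simp

lemma sets_gauss [measurable_cong, simp]: "sets (gauss v) = sets borel"
  by (simp add: gauss_def)

lemma space_gauss [simp]: "space (gauss v) = UNIV"
  by (simp add: gauss_def)

text \<open>Completing the square: \<open>- (x - m)^2 / (2 v)\<close> equals
  \<open>- x^2 / (2 v)\<close> plus \<open>(m x - m^2 / 2) / v\<close>. This is the Cameron-Martin
  formula in dimension one.\<close>

lemma gauss_shift:
  assumes "v > 0"
  shows "distr (gauss v) (gauss v) (\<lambda>x. m + x) = density (gauss v) (\<lambda>x. ennreal (exp ((m * x - m\<^sup>2 / 2) / v)))"
proof -
  interpret prob_space "gauss v" using assms by (rule prob_space_gauss)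
  have "distributed (gauss v) lborel (\<lambda>x. x) (normal_density 0 (sqrt v))"
    using assms by (auto simp: distributed_def gauss_def distr_id2)
  from normal_density_affine[OF this, of 1 m] assms
  have "distr (gauss v) lborel (\<lambda>x. m + x) = density lborel (normal_density m (sqrt v))"
    by (simp add: distributed_def)
  moreover have "distr (gauss v) (gauss v) (\<lambda>x. m + x) = distr (gauss v) lborel (\<lambda>x. m + x)"
    by (rule distr_cong) auto
  moreover have "density (gauss v) (\<lambda>x. ennreal (exp ((m * x - m\<^sup>2 / 2) / v))) =
     density lborel (normal_density m (sqrt v))"
    unfolding gauss_def
  proof (subst density_density_eq; simp?; intro density_cong AE_I2; simp?)
    fix x
    have "normal_density 0 (sqrt v) x * exp ((m * x - m\<^sup>2 / 2) / v) = normal_density m (sqrt v) x"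
      using assms by (simp add: normal_density_def exp_add[symmetric] field_simps power2_eq_square
         flip: exp_minus)
    then show "ennreal (normal_density 0 (sqrt v) x) * ennreal (exp ((m * x - m\<^sup>2 / 2) / v)) = ennreal (normal_density m (sqrt v) x)"
      by (simp flip: ennreal_mult')
  qed
  ultimately show ?thesis by simp
qed

text \<open>The density of the law translated by \<open>s\<close> has total mass 1; pulling out its
  normalizing constant gives the moment generating function. Read from right to left, it linearizes
  the square in the exponent.\<close>

lemma nn_integral_gauss_exp:
  "(\<integral>\<^sup>+x. ennreal (exp (s * x)) \<partial>gauss 1) = ennreal (exp (s\<^sup>2 / 2))"
proof -
  have "prob_space (density (gauss 1) (\<lambda>x. ennreal (exp (s * x - s\<^sup>2 / 2))))"
    using gauss_shift[of 1 s] prob_space.prob_space_distr[OF prob_space_gauss[of 1], of "\<lambda>x. s + x" "gauss 1"]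
    by simp
  then have "(\<integral>\<^sup>+x. ennreal (exp (s * x - s\<^sup>2 / 2)) \<partial>gauss 1) = 1"
    using prob_space.emeasure_space_1 by (fastforce simp: emeasure_density)
  moreover have "(\<integral>\<^sup>+x. ennreal (exp (s * x)) \<partial>gauss 1) =
      (\<integral>\<^sup>+x. ennreal (exp (s\<^sup>2 / 2)) * ennreal (exp (s * x - s\<^sup>2 / 2)) \<partial>gauss 1)"
    by (intro nn_integral_cong) (simp flip: ennreal_mult' exp_add)
  ultimately show ?thesis by (simp add: nn_integral_cmult)
qed

text \<open>Multiplied by the standard normal density, the integrand is a constant multiple of the
  centered normal density of variance \<open>1 / (1 - \<theta>)\<close>. The threshold of the
  theorem enters here, with \<theta> the square of \<open>lam * \<sigma>\<close>.\<close>

lemma nn_integral_gauss_exp_square: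
  assumes "\<theta> < 1"
  shows "(\<integral>\<^sup>+x. ennreal (exp (\<theta> * x\<^sup>2 / 2)) \<partial>gauss 1) < \<infinity>"
proof -
  have "(\<integral>\<^sup>+x. ennreal (exp (\<theta> * x\<^sup>2 / 2)) \<partial>gauss 1)
    = (\<integral>\<^sup>+x. ennreal (1 / sqrt (1 - \<theta>)) * ennreal (normal_density 0 (1 / sqrt (1 - \<theta>)) x) \<partial>lborel)"
    unfolding gauss_def
  proof (subst nn_integral_density; simp?; intro nn_integral_cong)
    fix x :: real
    have "std_normal_density x * exp (\<theta> * x\<^sup>2 / 2) = 1 / sqrt (1 - \<theta>) * normal_density 0 (1 / sqrt (1 - \<theta>)) x"
      using assms by (simp add: normal_density_def real_sqrt_divide real_sqrt_mult field_simps flip: exp_add)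
    then show "ennreal (std_normal_density x) * ennreal (exp (\<theta> * x\<^sup>2 / 2)) =
        ennreal (1 / sqrt (1 - \<theta>)) * ennreal (normal_density 0 (1 / sqrt (1 - \<theta>)) x)"
      using assms by (simp flip: ennreal_mult')
  qed
  also have "\<dots> = ennreal (1 / sqrt (1 - \<theta>)) * emeasure (density lborel (normal_density 0 (1 / sqrt (1 - \<theta>)))) UNIV"
    by (simp add: nn_integral_cmult emeasure_density)
  also have "\<dots> = ennreal (1 / sqrt (1 - \<theta>))"
    using prob_space.emeasure_space_1[OF prob_space_normal_density[of "1 / sqrt (1 - \<theta>)" 0]] assms by simp
  finally show ?thesis by simp
qed

section \<open>Gaussian location families on a product of products, and their second moments\<close>

text \<open>The outer index will be the representation and the inner one a noise component of its
  matrix. Both restrictions keep the result extensional, as the points of a nested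
  \<open>PiM\<close> must be.\<close>

definition location_shift ::
  "'r set \<Rightarrow> ('r \<Rightarrow> 'i set) \<Rightarrow> ('r \<Rightarrow> 'i \<Rightarrow> real) \<Rightarrow> ('r \<Rightarrow> 'i \<Rightarrow> real) \<Rightarrow> 'r \<Rightarrow> 'i \<Rightarrow> real"
where
  "location_shift R I m x = (\<lambda>r\<in>R. \<lambda>i\<in>I r. m r i + x r i)"

text \<open>The likelihood ratio of the Gaussian with mean \<open>m\<close> against the centered
  one; see \<open>distr_location_shift\<close>.\<close>

definition location_density ::
  "'r set \<Rightarrow> ('r \<Rightarrow> 'i set) \<Rightarrow> ('r \<Rightarrow> 'i \<Rightarrow> real) \<Rightarrow>
    ('r \<Rightarrow> 'i \<Rightarrow> real) \<Rightarrow> ('r \<Rightarrow> 'i \<Rightarrow> real) \<Rightarrow> real"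
where
  "location_density R I v m x = exp (\<Sum>r\<in>R. \<Sum>i\<in>I r. (m r i * x r i - (m r i)\<^sup>2 / 2) / v r i)"

definition gauss_product ::
  "'r set \<Rightarrow> ('r \<Rightarrow> 'i set) \<Rightarrow> ('r \<Rightarrow> 'i \<Rightarrow> real) \<Rightarrow> ('r \<Rightarrow> 'i \<Rightarrow> real) measure"
where
  "gauss_product R I v = PiM R (\<lambda>r. PiM (I r) (\<lambda>i. gauss (v r i)))"

lemma measurable_gauss_product_component:
  assumes "r \<in> R" "i \<in> I r" "f \<in> measurable M (gauss_product R I v)"
  shows "(\<lambda>x. f x r i) \<in> borel_measurable M"
proof -
  have "(\<lambda>x. x i) \<in> measurable (PiM (I r) (\<lambda>i. gauss (v r i))) (gauss (v r i))"
    using assms(2) by (rule measurable_component_singleton)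
  from measurable_compose[OF measurable_component_singleton[OF assms(1), of "\<lambda>r. PiM (I r) (\<lambda>i. gauss (v r i))"] this]
  have "(\<lambda>y. y r i) \<in> borel_measurable (gauss_product R I v)"
    by (simp add: gauss_product_def measurable_cong_sets[OF refl sets_gauss])
  from measurable_compose[OF assms(3) this] show ?thesis .
qed

locale gauss_family =
  fixes R :: "'r set" and I :: "'r \<Rightarrow> 'i set" and v :: "'r \<Rightarrow> 'i \<Rightarrow> real"
  assumes finR: "finite R" and finI: "\<And>r. r \<in> R \<Longrightarrow> finite (I r)"
    and v_pos: "\<And>r i. r \<in> R \<Longrightarrow> i \<in> I r \<Longrightarrow> v r i > 0"
begin

abbreviation "N \<equiv> gauss_product R I v"

lemma prob_space_inner: "r \<in> R \<Longrightarrow> prob_space (PiM (I r) (\<lambda>i. gauss (v r i)))"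
  by (intro prob_space_PiM prob_space_gauss v_pos)

lemma prob_space_N: "prob_space N"
  unfolding gauss_product_def by (intro prob_space_PiM prob_space_inner)

lemma measurable_location_shift:
  assumes [measurable]: "\<And>r i. r \<in> R \<Longrightarrow> i \<in> I r \<Longrightarrow> (\<lambda>z. m z r i) \<in> borel_measurable M"
    and [measurable]: "h \<in> measurable M N"
  shows "(\<lambda>z. location_shift R I (m z) (h z)) \<in> measurable M N"
proof -
  have "(\<lambda>z. m z r i + h z r i) \<in> measurable M (gauss (v r i))" if "r \<in> R" "i \<in> I r" for r i
    using that measurable_gauss_product_component[OF that assms(2)] by simp
  then show ?thesis
    unfolding location_shift_def gauss_product_def by (intro measurable_restrict)
qed

lemma measurable_location_density:
  assumes "\<And>r i. r \<in> R \<Longrightarrow> i \<in> I r \<Longrightarrow> (\<lambda>z. m z r i) \<in> borel_measurable M"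
    and "h \<in> measurable M N"
  shows "(\<lambda>z. location_density R I v (m z) (h z)) \<in> borel_measurable M"
  unfolding location_density_def
  by (intro borel_measurable_exp[THEN measurable_compose[rotated]] borel_measurable_sum
      borel_measurable_divide borel_measurable_diff borel_measurable_times borel_measurable_power
      borel_measurable_const assms(1) measurable_gauss_product_component[OF _ _ assms(2)])

text \<open>\<open>gauss_shift\<close> handles one coordinate; \<open>PiM_distr\<close> and
  \<open>PiM_density\<close> lift it first to the inner products and then to the outer one.\<close>

lemma distr_location_shift:
  "distr N N (location_shift R I m) = density N (\<lambda>x. ennreal (location_density R I v m x))"
proof -
  define L where "L r i x = ennreal (exp ((m r i * x - (m r i)\<^sup>2 / 2) / v r i))" for r i x
  have [measurable]: "L r i \<in> borel_measurable borel" for r i unfolding L_def by measurable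
  have g: "distr (gauss (v r i)) (gauss (v r i)) ((+) (m r i)) = density (gauss (v r i)) (L r i)"
    if "r \<in> R" "i \<in> I r" for r i
    using gauss_shift[OF v_pos[OF that], of "m r i"] by (simp add: L_def[abs_def])
  have p: "prob_space (density (gauss (v r i)) (L r i))" if "r \<in> R" "i \<in> I r" for r i
    unfolding g[OF that, symmetric]
    by (intro prob_space.prob_space_distr prob_space_gauss v_pos that) simp
  define M where "M r = PiM (I r) (\<lambda>i. gauss (v r i))" for r
  define S where "S r x = (\<lambda>i\<in>I r. m r i + x i)" for r and x :: "'i \<Rightarrow> real"
  have S [measurable]: "S r \<in> measurable (M r) (M r)" for r
    unfolding S_def M_def by (intro measurable_restrict) simp
  have h: "distr (M r) (M r) (S r) = density (M r) (\<lambda>x. \<Prod>i\<in>I r. L r i (x i))" if "r \<in> R" for r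
  proof -
    have "distr (M r) (M r) (S r) = PiM (I r) (\<lambda>i. distr (gauss (v r i)) (gauss (v r i)) ((+) (m r i)))"
      unfolding M_def S_def using that
      by (intro PiM_distr) (auto simp: finI intro: prob_space_gauss v_pos)
    also have "\<dots> = PiM (I r) (\<lambda>i. density (gauss (v r i)) (L r i))"
      using that by (intro PiM_cong refl g)
    also have "\<dots> = density (M r) (\<lambda>x. \<Prod>i\<in>I r. L r i (x i))"
      unfolding M_def using that
      by (intro PiM_density) (auto simp: finI measurable_cong_sets[OF sets_gauss refl] intro: prob_space_gauss v_pos p)
    finally show ?thesis .
  qed
  have N: "N = PiM R M" by (simp add: gauss_product_def M_def[abs_def])
  have pM: "prob_space (M r)" if "r \<in> R" for r using prob_space_inner[OF that] by (simp add: M_def)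
  have "distr N N (location_shift R I m) = PiM R (\<lambda>r. distr (M r) (M r) (S r))"
    unfolding N using PiM_distr[of R M S M] finR pM S
    by (simp add: S_def[abs_def] location_shift_def[abs_def])
  also have "\<dots> = PiM R (\<lambda>r. density (M r) (\<lambda>x. \<Prod>i\<in>I r. L r i (x i)))"
    by (intro PiM_cong refl h)
  also have "\<dots> = density N (\<lambda>x. \<Prod>r\<in>R. \<Prod>i\<in>I r. L r i (x r i))"
    unfolding N
  proof (intro PiM_density finR pM)
    fix r assume r: "r \<in> R"
    show "(\<lambda>x. \<Prod>i\<in>I r. L r i (x i)) \<in> borel_measurable (M r)" unfolding M_def by measurable
    show "prob_space (density (M r) (\<lambda>x. \<Prod>i\<in>I r. L r i (x i)))"
      unfolding h[OF r, symmetric] by (intro prob_space.prob_space_distr pM r S)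
  qed
  also have "(\<lambda>x. \<Prod>r\<in>R. \<Prod>i\<in>I r. L r i (x r i)) = (\<lambda>x. ennreal (location_density R I v m x))"
    unfolding location_density_def L_def
    by (simp add: exp_sum finR finI prod_ennreal prod_nonneg cong: prod.cong)
  finally show ?thesis .
qed

lemma nn_integral_location_density: "(\<integral>\<^sup>+x. ennreal (location_density R I v m x) \<partial>N) = 1"
proof -
  have [measurable]: "location_shift R I m \<in> measurable N N"
    by (intro measurable_location_shift) simp_all
  have [measurable]: "location_density R I v m \<in> borel_measurable N"
    by (intro measurable_location_density) simp_all
  have "prob_space (density N (\<lambda>x. ennreal (location_density R I v m x)))"
    unfolding distr_location_shift[symmetric]
    by (intro prob_space.prob_space_distr prob_space_N) simp
  from prob_space.emeasure_space_1[OF this] show ?thesis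
    by (simp add: emeasure_density cong: nn_integral_cong_simp)
qed

lemma location_density_nonneg: "0 \<le> location_density R I v m x"
  by (simp add: location_density_def)

text \<open>Since \<open>(m + m')^2\<close> exceeds \<open>m^2 + m'^2\<close> by
  \<open>2 m m'\<close>, the product of the two densities is a constant times the density for the
  mean \<open>m + m'\<close>, which integrates to 1. The constant is the exponential of the overlap
  of the means.\<close>

lemma nn_integral_location_density_mult:
  "(\<integral>\<^sup>+x. ennreal (location_density R I v m x) * ennreal (location_density R I v m' x) \<partial>N)
    = ennreal (exp (\<Sum>r\<in>R. \<Sum>i\<in>I r. m r i * m' r i / v r i))"
proof -
  have [measurable]: "location_density R I v m \<in> borel_measurable N" for m
    by (intro measurable_location_density) simp_all
  have eq: "location_density R I v m x * location_density R I v m' x =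
     exp (\<Sum>r\<in>R. \<Sum>i\<in>I r. m r i * m' r i / v r i) * location_density R I v (\<lambda>r i. m r i + m' r i) x" for x
    unfolding location_density_def exp_add[symmetric] sum.distrib[symmetric]
    by (intro arg_cong[where f=exp] sum.cong refl)
       (simp add: add_divide_distrib[symmetric] power2_eq_square algebra_simps)
  have "(\<integral>\<^sup>+x. ennreal (location_density R I v m x) * ennreal (location_density R I v m' x) \<partial>N)
    = (\<integral>\<^sup>+x. ennreal (exp (\<Sum>r\<in>R. \<Sum>i\<in>I r. m r i * m' r i / v r i)) *
        ennreal (location_density R I v (\<lambda>r i. m r i + m' r i) x) \<partial>N)"
    by (simp only: eq ennreal_mult'[OF exp_ge_zero, symmetric] ennreal_mult'[OF location_density_nonneg, symmetric])
  then show ?thesis by (simp add: nn_integral_cmult nn_integral_location_density)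
qed

text \<open>The likelihood ratio \<open>L\<close> of a mixture satisfies \<open>L \<le> c + L\<^sup>2 / c\<close>; this replaces the
  Cauchy-Schwarz inequality in the second moment method.\<close>

lemma location_mixture_bound:
  assumes "prob_space \<nu>"
    and m: "\<And>r i. r \<in> R \<Longrightarrow> i \<in> I r \<Longrightarrow> (\<lambda>g. m g r i) \<in> borel_measurable \<nu>"
    and B [measurable]: "B \<in> sets N" and "c > 0"
    and bound: "\<And>g. g \<in> space \<nu> \<Longrightarrow>
      (\<integral>\<^sup>+g'. ennreal (exp (\<Sum>r\<in>R. \<Sum>i\<in>I r. m g r i * m g' r i / v r i)) \<partial>\<nu>) \<le> K"
  shows "emeasure (\<nu> \<Otimes>\<^sub>M N) ((\<lambda>(g, x). location_shift R I (m g) x) -` B \<inter> space (\<nu> \<Otimes>\<^sub>M N))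
    \<le> ennreal c * emeasure N B + K / ennreal c"
proof -
  interpret nu: prob_space \<nu> by fact
  interpret N: prob_space N by (rule prob_space_N)
  interpret P: pair_sigma_finite \<nu> N ..
  define L where "L g x = ennreal (location_density R I v (m g) x)" for g x
  have mm: "(\<lambda>z. m (f z) r i) \<in> borel_measurable M"
    if "r \<in> R" "i \<in> I r" "f \<in> measurable M \<nu>" for f and M :: "'z measure" and r i
    using measurable_compose[OF that(3) m[OF that(1,2)]] .
  have L [measurable (raw)]: "(\<lambda>z. L (f z) (h z)) \<in> borel_measurable M"
    if [measurable]: "f \<in> measurable M \<nu>" "h \<in> measurable M N" for f h and M :: "'z measure"
    unfolding L_def
    by (intro measurable_compose[OF _ measurable_ennreal] measurable_location_density mm that)
  have S [measurable]: "(\<lambda>(g, x). location_shift R I (m g) x) \<in> measurable (\<nu> \<Otimes>\<^sub>M N) N"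
    unfolding case_prod_unfold by (intro measurable_location_shift mm) simp_all
  \<comment> \<open>The likelihood ratio of the mixture: the ratios for fixed \<open>g\<close>
    averaged over \<nu>.\<close>
  define Lm where "Lm x = (\<integral>\<^sup>+g. L g x \<partial>\<nu>)" for x
  have Lm [measurable]: "Lm \<in> borel_measurable N" unfolding Lm_def by measurable
  have "emeasure (\<nu> \<Otimes>\<^sub>M N) ((\<lambda>(g, x). location_shift R I (m g) x) -` B \<inter> space (\<nu> \<Otimes>\<^sub>M N))
    = (\<integral>\<^sup>+z. indicator B ((\<lambda>(g, x). location_shift R I (m g) x) z) \<partial>(\<nu> \<Otimes>\<^sub>M N))"
    unfolding nn_integral_indicator[symmetric, OF measurable_sets[OF S B]]
    by (intro nn_integral_cong) (auto simp: indicator_def)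
  also have "\<dots> = (\<integral>\<^sup>+g. \<integral>\<^sup>+x. indicator B (location_shift R I (m g) x) \<partial>N \<partial>\<nu>)"
    by (subst N.nn_integral_fst[symmetric]) auto
  also have "\<dots> = (\<integral>\<^sup>+g. \<integral>\<^sup>+x. indicator B x * L g x \<partial>N \<partial>\<nu>)"
  proof (rule nn_integral_cong)
    fix g assume g: "g \<in> space \<nu>"
    have [measurable]: "location_shift R I (m g) \<in> measurable N N"
      using measurable_Pair2[OF S g] by simp
    have "(\<integral>\<^sup>+x. indicator B (location_shift R I (m g) x) \<partial>N) = (\<integral>\<^sup>+x. indicator B x \<partial>distr N N (location_shift R I (m g)))"
      by (subst nn_integral_distr) simp_all
    also have "\<dots> = (\<integral>\<^sup>+x. indicator B x * L g x \<partial>N)"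
      unfolding distr_location_shift using g
      by (subst nn_integral_density) (simp_all add: L_def[symmetric] mult.commute)
    finally show "(\<integral>\<^sup>+x. indicator B (location_shift R I (m g) x) \<partial>N) = (\<integral>\<^sup>+x. indicator B x * L g x \<partial>N)" .
  qed
  also have "\<dots> = (\<integral>\<^sup>+x. \<integral>\<^sup>+g. indicator B x * L g x \<partial>\<nu> \<partial>N)"
    by (intro P.Fubini'[symmetric]) measurable
  also have "\<dots> = (\<integral>\<^sup>+x. indicator B x * Lm x \<partial>N)"
    by (intro nn_integral_cong) (simp add: Lm_def nn_integral_cmult)
  also have "\<dots> \<le> (\<integral>\<^sup>+x. ennreal c * indicator B x + Lm x * Lm x / ennreal c \<partial>N)"
  proof (intro nn_integral_mono)
    fix x
    \<comment> \<open>If \<open>l\<close> exceeds \<open>c\<close>, then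
      \<open>l = l * c / c\<close> is at most \<open>l * l / c\<close>. The cancellation is valid in
      the extended reals because \<open>c\<close> is positive and finite.\<close>
    have "l \<le> ennreal c + l * l / ennreal c" for l
    proof (cases "l \<le> ennreal c")
      case False
      then have "l * ennreal c \<le> l * l" by (intro mult_left_mono) auto
      then have "l * ennreal c / ennreal c \<le> l * l / ennreal c" by (rule divide_right_mono_ennreal)
      moreover have "l * ennreal c / ennreal c = l"
        using \<open>c > 0\<close> by (intro ennreal_mult_divide_eq) auto
      ultimately show ?thesis by (auto intro: order_trans)
    qed (auto intro: order_trans)
    then show "indicator B x * Lm x \<le> ennreal c * indicator B x + Lm x * Lm x / ennreal c"
      by (auto simp: indicator_def)
  qed
  also have "\<dots> = ennreal c * emeasure N B + (\<integral>\<^sup>+x. Lm x * Lm x \<partial>N) / ennreal c"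
    by (simp add: nn_integral_add nn_integral_cmult nn_integral_divide)
  \<comment> \<open>The square of \<open>Lm\<close> is written with two independent copies
    \<open>g\<close> and \<open>g'\<close>. Moving the integral over \<open>x\<close> innermost then
    leaves only the overlap of their means, to which \<open>bound\<close> applies for each
    \<open>g\<close>.\<close>
  also have "(\<integral>\<^sup>+x. Lm x * Lm x \<partial>N) = (\<integral>\<^sup>+x. \<integral>\<^sup>+g. L g x * Lm x \<partial>\<nu> \<partial>N)"
    by (intro nn_integral_cong) (simp add: Lm_def nn_integral_multc)
  also have "\<dots> = (\<integral>\<^sup>+g. \<integral>\<^sup>+x. L g x * Lm x \<partial>N \<partial>\<nu>)"
    by (intro P.Fubini') measurable
  also have "\<dots> = (\<integral>\<^sup>+g. \<integral>\<^sup>+x. \<integral>\<^sup>+g'. L g x * L g' x \<partial>\<nu> \<partial>N \<partial>\<nu>)"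
    by (intro nn_integral_cong) (simp add: Lm_def nn_integral_cmult)
  also have "\<dots> = (\<integral>\<^sup>+g. \<integral>\<^sup>+g'. \<integral>\<^sup>+x. L g x * L g' x \<partial>N \<partial>\<nu> \<partial>\<nu>)"
    by (intro nn_integral_cong P.Fubini') measurable
  also have "\<dots> = (\<integral>\<^sup>+g. \<integral>\<^sup>+g'. ennreal (exp (\<Sum>r\<in>R. \<Sum>i\<in>I r. m g r i * m g' r i / v r i)) \<partial>\<nu> \<partial>\<nu>)"
    unfolding L_def nn_integral_location_density_mult ..
  also have "\<dots> \<le> (\<integral>\<^sup>+g. K \<partial>\<nu>)"
    by (intro nn_integral_mono bound)
  also have "\<dots> = K" by (simp add: nu.emeasure_space_1)
  finally show ?thesis by (simp add: add_left_mono divide_right_mono_ennreal)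
qed

end

section \<open>Quaternionic Gram matrices\<close>

lemma quat_sel [simp]:
  "qre 0 = 0" "qi 0 = 0" "qj 0 = 0" "qk 0 = 0"
  "qre (p + q) = qre p + qre q" "qi (p + q) = qi p + qi q"
  "qj (p + q) = qj p + qj q" "qk (p + q) = qk p + qk q"
  "qre (r *\<^sub>R q) = r * qre q" "qi (r *\<^sub>R q) = r * qi q"
  "qj (r *\<^sub>R q) = r * qj q" "qk (r *\<^sub>R q) = r * qk q"
  "qre (p * q) = qre p * qre q - qi p * qi q - qj p * qj q - qk p * qk q"
  "qi (p * q) = qre p * qi q + qi p * qre q + qj p * qk q - qk p * qj q"
  "qj (p * q) = qre p * qj q - qi p * qk q + qj p * qre q + qk p * qi q"
  "qk (p * q) = qre p * qk q + qi p * qj q - qj p * qi q + qk p * qre q"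
  "qre (qcnj q) = qre q" "qi (qcnj q) = - qi q" "qj (qcnj q) = - qj q" "qk (qcnj q) = - qk q"
  by (simp_all add: zero_quat_def plus_quat_def scaleR_quat_def times_quat_def qcnj_def)

lemma qcnj_mult: "qcnj (p * q) = qcnj q * qcnj p"
  by (rule quat.expand) simp

lemma qcnj_qcnj [simp]: "qcnj (qcnj q) = q"
  by (rule quat.expand) simp

lemma qcnj_add: "qcnj (p + q) = qcnj p + qcnj q"
  by (rule quat.expand) simp

lemma qcnj_0 [simp]: "qcnj 0 = 0"
  by (rule quat.expand) simp

lemma qcnj_sum: "qcnj (sum f A) = (\<Sum>x\<in>A. qcnj (f x))"
  by (induction A rule: infinite_finite_induct) (simp_all add: qcnj_add)

lemma qcomp_add [simp]: "qcomp c (p + q) = qcomp c p + qcomp c q"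
  by (simp add: qcomp_def)

lemma qcomp_0 [simp]: "qcomp c 0 = 0"
  by (simp add: qcomp_def)

lemma qcomp_scaleR [simp]: "qcomp c (r *\<^sub>R q) = r * qcomp c q"
  by (simp add: qcomp_def)

lemma qcomp_sum: "qcomp c (sum f A) = (\<Sum>x\<in>A. qcomp c (f x))"
  by (induction A rule: infinite_finite_induct) simp_all

lemma qcomp_qcnj: "qcomp c (qcnj q) = (if c = 0 then 1 else - 1) * qcomp c q"
  by (simp add: qcomp_def)

lemma quat_eqI: "(\<And>c. c < 4 \<Longrightarrow> qcomp c p = qcomp c q) \<Longrightarrow> p = q"
  using quat.expand[of p q] by (force simp: qcomp_def split: if_splits)

lemma qre_mult_commute: "qre (p * q) = qre (q * p)"
  by simp

lemma qre_sum: "qre (sum f A) = (\<Sum>x\<in>A. qre (f x))"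
  by (induction A rule: infinite_finite_induct) (simp_all del: quat_sel(13))

text \<open>The link between the two languages: sums over independent real components on the
  Gaussian side are real parts of products on the matrix side.\<close>

lemma qre_mult_qcnj: "qre (p * qcnj q) = (\<Sum>c<4. qcomp c p * qcomp c q)"
  by (simp add: qcomp_def numeral_eq_Suc)

text \<open>This is \<open>\<langle>X X\<^sup>*, Y Y\<^sup>*\<rangle> = \<parallel>X\<^sup>* Y\<parallel>\<^sup>2\<close>. It survives
  noncommutativity because the real part of a product is invariant under cyclic rotation.\<close>

lemma qre_gram_inner:
  fixes X Y :: "nat \<Rightarrow> nat \<Rightarrow> quat" and N d :: nat
  defines "E \<equiv> \<lambda>k l. \<Sum>i<N. qcnj (X i k) * Y i l"
  shows "(\<Sum>i<N. \<Sum>j<N. qre ((\<Sum>k<d. X i k * qcnj (X j k)) * qcnj (\<Sum>l<d. Y i l * qcnj (Y j l))))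
    = (\<Sum>k<d. \<Sum>l<d. qre (E k l * qcnj (E k l)))"
proof -
  have "(\<Sum>i<N. \<Sum>j<N. qre ((\<Sum>k<d. X i k * qcnj (X j k)) * qcnj (\<Sum>l<d. Y i l * qcnj (Y j l))))
    = (\<Sum>i<N. \<Sum>j<N. \<Sum>k<d. \<Sum>l<d. qre (X i k * (qcnj (X j k) * Y j l * qcnj (Y i l))))"
    by (simp add: qcnj_sum sum_product qcnj_mult qre_sum mult.assoc del: quat_sel(13))
  \<comment> \<open>Rotating \<open>X i k\<close> to the end places all factors indexed by
    \<open>j\<close> before all those indexed by \<open>i\<close>, so that the double sum can be
    factored.\<close>
  also have "\<dots> = (\<Sum>i<N. \<Sum>j<N. \<Sum>k<d. \<Sum>l<d. qre (qcnj (X j k) * Y j l * qcnj (Y i l) * X i k))"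
    by (subst qre_mult_commute) simp
  \<comment> \<open>With \<open>k\<close>, \<open>l\<close> outermost, the sum over \<open>j\<close>
    yields \<open>E k l\<close> and the sum over \<open>i\<close> its conjugate, whose summands are
    \<open>qcnj (Y i l) * X i k\<close>.\<close>
  also have "\<dots> = (\<Sum>k<d. \<Sum>l<d. \<Sum>j<N. \<Sum>i<N. qre (qcnj (X j k) * Y j l * qcnj (Y i l) * X i k))"
    by (subst sum.swap, subst sum.swap[of _ "{..<N}" "{..<d}"], subst sum.swap[of _ "{..<N}" "{..<d}"])
       (simp add: sum.swap[of _ "{..<N}" "{..<d}"] del: quat_sel)
  also have "\<dots> = (\<Sum>k<d. \<Sum>l<d. qre (E k l * qcnj (E k l)))"
    by (simp add: E_def qcnj_sum sum_product qcnj_mult qre_sum mult.assoc del: quat_sel(13))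
  finally show ?thesis .
qed

section \<open>Hermitian matrices over the three subalgebras and their independent
  components\<close>

lemma type_algebra_iff:
  "q \<in> type_algebra t \<longleftrightarrow> (t \<noteq> Quaternionic_type \<longrightarrow> qj q = 0 \<and> qk q = 0) \<and> (t = Real_type \<longrightarrow> qi q = 0)"
proof
  assume "q \<in> type_algebra t"
  then have "rbeta t \<le> c \<Longrightarrow> qcomp c q = 0" for c by (simp add: type_algebra_def)
  from this[of 1] this[of 2] this[of 3]
  show "(t \<noteq> Quaternionic_type \<longrightarrow> qj q = 0 \<and> qk q = 0) \<and> (t = Real_type \<longrightarrow> qi q = 0)"
    by (cases t) (simp_all add: qcomp_def)
next
  assume "(t \<noteq> Quaternionic_type \<longrightarrow> qj q = 0 \<and> qk q = 0) \<and> (t = Real_type \<longrightarrow> qi q = 0)"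
  then show "q \<in> type_algebra t"
    by (cases t) (simp_all add: type_algebra_def qcomp_def)
qed

lemma type_algebra_mult: "p \<in> type_algebra t \<Longrightarrow> q \<in> type_algebra t \<Longrightarrow> p * q \<in> type_algebra t"
  by (cases t) (auto simp: type_algebra_iff)

lemma type_algebra_qcnj: "q \<in> type_algebra t \<Longrightarrow> qcnj q \<in> type_algebra t"
  by (auto simp: type_algebra_def qcomp_qcnj)

lemma type_algebra_sum: "(\<And>x. x \<in> A \<Longrightarrow> f x \<in> type_algebra t) \<Longrightarrow> sum f A \<in> type_algebra t"
  by (auto simp: type_algebra_def qcomp_sum)

lemma rbeta_pos [simp]: "rbeta t > 0"
  by (cases t) auto

lemma rbeta_le_4: "rbeta t \<le> 4"
  by (cases t) auto

definition ensemble_variance :: "rtype \<Rightarrow> nat \<times> nat \<times> nat \<Rightarrow> real" where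
  "ensemble_variance t = (\<lambda>(i, j, c). if i = j then 2 / real (rbeta t) else 1 / real (rbeta t))"

lemma ensemble_index_eq:
  "ensemble_index t N = {x \<in> {..<N} \<times> {..<N} \<times> {..<rbeta t}. (\<lambda>(i, j, c). i \<le> j \<and> (i = j \<longrightarrow> c = 0)) x}"
  by (auto simp: ensemble_index_def)

lemma finite_ensemble_index: "finite (ensemble_index t N)"
  unfolding ensemble_index_eq by simp

text \<open>The strictly lower triangle contributes the same as the strictly upper one, which is
  therefore counted twice.\<close>

lemma sum_symmetric:
  fixes F :: "nat \<Rightarrow> nat \<Rightarrow> real"
  assumes "\<And>i j. i < N \<Longrightarrow> j < N \<Longrightarrow> F i j = F j i"
  shows "(\<Sum>i<N. \<Sum>j<N. F i j) = (\<Sum>i<N. \<Sum>j<N. if i < j then 2 * F i j else if i = j then F i j else 0)"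
proof -
  have "(\<Sum>i<N. \<Sum>j<N. if j < i then F i j else 0) = (\<Sum>i<N. \<Sum>j<N. if i < j then F i j else 0)"
    by (subst sum.swap) (auto intro!: sum.cong simp: assms)
  moreover have "F i j = (if i < j then F i j else 0) + (if i = j then F i j else 0) + (if j < i then F i j else 0)" for i j
    by auto
  then have "(\<Sum>i<N. \<Sum>j<N. F i j) = (\<Sum>i<N. \<Sum>j<N. if i < j then F i j else 0) +
      (\<Sum>i<N. \<Sum>j<N. if i = j then F i j else 0) + (\<Sum>i<N. \<Sum>j<N. if j < i then F i j else 0)"
    by (simp only: sum.distrib[symmetric]) 
  ultimately have "(\<Sum>i<N. \<Sum>j<N. F i j) =
     (\<Sum>i<N. \<Sum>j<N. 2 * (if i < j then F i j else 0) + (if i = j then F i j else 0))"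
    by (simp add: sum.distrib sum_distrib_left)
  also have "\<dots> = (\<Sum>i<N. \<Sum>j<N. if i < j then 2 * F i j else if i = j then F i j else 0)"
    by (intro sum.cong) auto
  finally show ?thesis .
qed

text \<open>An entry above the diagonal has variance \<open>1 / \<beta>\<close> and occurs twice in the Frobenius inner
  product; a diagonal entry has variance \<open>2 / \<beta>\<close> and occurs once.\<close>

lemma sum_ensemble_index:
  assumes P: "\<And>i j. i < N \<Longrightarrow> j < N \<Longrightarrow> P i j \<in> type_algebra t \<and> P j i = qcnj (P i j)"
    and Q: "\<And>i j. i < N \<Longrightarrow> j < N \<Longrightarrow> Q i j \<in> type_algebra t \<and> Q j i = qcnj (Q i j)"
  shows "(\<Sum>x\<in>ensemble_index t N. (\<lambda>(i, j, c). qcomp c (P i j) * qcomp c (Q i j)) x / ensemble_variance t x)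
    = real (rbeta t) / 2 * (\<Sum>i<N. \<Sum>j<N. qre (P i j * qcnj (Q i j)))" (is "?L = ?R")
proof -
  define F where "F i j = qre (P i j * qcnj (Q i j))" for i j
  \<comment> \<open>Elements of \<open>type_algebra t\<close> have vanishing components from
    \<open>rbeta t\<close> onwards, so the sum over four components can be truncated.\<close>
  have F: "F i j = (\<Sum>c<rbeta t. qcomp c (P i j) * qcomp c (Q i j))" if "i < N" "j < N" for i j
    unfolding F_def qre_mult_qcnj using P[OF that] rbeta_le_4[of t]
    by (intro sum.mono_neutral_right) (auto simp: type_algebra_def)
  have sym: "F i j = F j i" if "i < N" "j < N" for i j
    unfolding F_def using P[OF that] Q[OF that] by simp
  \<comment> \<open>Diagonal entries of a Hermitian matrix are self-conjugate, hence real. So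
    indexing only \<open>c = 0\<close> on the diagonal loses nothing.\<close>
  have diag: "qcomp c (P i i) = 0" if "i < N" "c > 0" for i c
  proof -
    have "qcomp c (P i i) = qcomp c (qcnj (P i i))" using P[OF that(1) that(1)] by simp
    then show ?thesis using that(2) by (simp add: qcomp_qcnj)
  qed
  have "?L = (\<Sum>i<N. \<Sum>j<N. \<Sum>c<rbeta t. if i \<le> j \<and> (i = j \<longrightarrow> c = 0)
      then qcomp c (P i j) * qcomp c (Q i j) / ensemble_variance t (i, j, c) else 0)"
    unfolding ensemble_index_eq
    by (subst sum.inter_filter) (auto simp: sum.cartesian_product intro!: sum.cong)
  also have "\<dots> = (\<Sum>i<N. \<Sum>j<N. real (rbeta t) / 2 * (if i < j then 2 * F i j else if i = j then F i j else 0))"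
  proof (intro sum.cong refl)
    fix i j assume "i \<in> {..<N}" "j \<in> {..<N}"
    then have [simp]: "i < N" "j < N" by auto
    show "(\<Sum>c<rbeta t. if i \<le> j \<and> (i = j \<longrightarrow> c = 0)
        then qcomp c (P i j) * qcomp c (Q i j) / ensemble_variance t (i, j, c) else 0)
      = real (rbeta t) / 2 * (if i < j then 2 * F i j else if i = j then F i j else 0)"
    proof (cases i j rule: linorder_cases)
      case less
      then show ?thesis by (simp add: F ensemble_variance_def sum_distrib_left mult_ac)
    next
      case equal
      have "(\<Sum>c<rbeta t. if c = 0 then qcomp c (P j j) * qcomp c (Q j j) * real (rbeta t) / 2 else 0)
        = (\<Sum>c<rbeta t. real (rbeta t) / 2 * (qcomp c (P j j) * qcomp c (Q j j)))"
        by (intro sum.cong) (auto simp: diag)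
      with equal show ?thesis by (simp add: F ensemble_variance_def sum_distrib_left)
    next
      case greater
      then show ?thesis by simp
    qed
  qed
  also have "\<dots> = ?R"
    using sum_symmetric[of N F, OF sym] by (simp add: F_def sum_distrib_left)
  finally show ?thesis .
qed

section \<open>Exponential moments and representations\<close>

text \<open>An auxiliary Gaussian \<open>y\<close> makes the exponent linear, after which the
  integral over the \<open>n\<close> coordinates factorizes and \<open>sub\<close> applies to each
  factor with \<open>v = b y\<close>. The functions \<open>w u\<close> may differ with
  \<open>u\<close> because they will be \<open>Z_vec\<close> composed with different
  translations.\<close>

lemma nn_integral_exp_sum_squares:
  fixes w :: "nat \<Rightarrow> 'a \<Rightarrow> 'k \<Rightarrow> real"
  assumes "prob_space \<mu>" and K: "finite K" and n: "n > 0"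
    and w: "\<And>u k. u < n \<Longrightarrow> k \<in> K \<Longrightarrow> (\<lambda>x. w u x k) \<in> borel_measurable \<mu>"
    and sub: "\<And>u v. u < n \<Longrightarrow>
      (\<integral>\<^sup>+x. ennreal (exp (\<Sum>k\<in>K. w u x k * v k)) \<partial>\<mu>) \<le> ennreal (exp (1/2 * s * (\<Sum>k\<in>K. (v k)\<^sup>2)))"
  shows "(\<integral>\<^sup>+x. ennreal (exp (a\<^sup>2 / 2 * (\<Sum>k\<in>K. (\<Sum>u<n. w u (x u) k)\<^sup>2 / real n))) \<partial>PiM {..<n} (\<lambda>_. \<mu>))
    \<le> (\<integral>\<^sup>+x. ennreal (exp (a\<^sup>2 * s * x\<^sup>2 / 2)) \<partial>gauss 1) ^ card K" (is "?L \<le> _")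
proof -
  interpret mu: prob_space \<mu> by fact
  interpret P: product_sigma_finite "\<lambda>_::nat. \<mu>" ..
  interpret PG: product_sigma_finite "\<lambda>_::'k. gauss 1"
    by (auto simp: product_sigma_finite_def prob_space_gauss prob_space_imp_sigma_finite)
  let ?M = "PiM {..<n} (\<lambda>_. \<mu>)" and ?G = "PiM K (\<lambda>_. gauss 1)"
  interpret M: prob_space ?M by (intro prob_space_PiM assms(1))
  interpret Gs: prob_space ?G by (intro prob_space_PiM prob_space_gauss) simp
  interpret MG: pair_sigma_finite ?M ?G ..
  \<comment> \<open>The scaling absorbs the division by \<open>n\<close>: the \<open>n\<close>
    factors, each with exponent proportional to \<open>s * b^2\<close>, together give
    \<open>s * a^2\<close>, so the final bound is free of \<open>n\<close>.\<close>
  define b where "b = a / sqrt (real n)"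
  have b2: "b\<^sup>2 = a\<^sup>2 / real n" using n by (simp add: b_def power_divide)
  have wm: "(\<lambda>z. w u (f z u) k) \<in> borel_measurable M'"
    if "u < n" "k \<in> K" "f \<in> measurable M' ?M" for u k f and M' :: "'z measure"
  proof -
    have "(\<lambda>x. x u) \<in> measurable ?M \<mu>"
      using that(1) by (intro measurable_component_singleton) simp
    from measurable_compose[OF that(3) measurable_compose[OF this w[OF that(1,2)]]] show ?thesis .
  qed
  have gm: "(\<lambda>z. f z k) \<in> borel_measurable M'"
    if "k \<in> K" "f \<in> measurable M' ?G" for k f and M' :: "'z measure"
  proof -
    have "(\<lambda>x. x k) \<in> measurable ?G (gauss 1)"
      using that(1) by (rule measurable_component_singleton)
    from measurable_compose[OF that(2) this] show ?thesis
      by (simp add: measurable_cong_sets[OF refl sets_gauss])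
  qed
  \<comment> \<open>Each factor \<open>exp ((b S)^2 / 2)\<close>, with \<open>S\<close> the sum over
    \<open>u\<close> for a fixed \<open>k\<close>, is replaced by the exponential moment of a fresh
    Gaussian variable.\<close>
  have "?L = (\<integral>\<^sup>+x. (\<Prod>k\<in>K. \<integral>\<^sup>+y. ennreal (exp (b * (\<Sum>u<n. w u (x u) k) * y)) \<partial>gauss 1) \<partial>?M)"
  proof -
    have "(\<Sum>k\<in>K. (b * S k)\<^sup>2 / 2) = a\<^sup>2 / 2 * (\<Sum>k\<in>K. (S k)\<^sup>2 / real n)" for S :: "'k \<Rightarrow> real"
      by (simp add: power_mult_distrib b2 sum_distrib_left mult.commute)
    then show ?thesis
      by (simp only: nn_integral_gauss_exp prod_ennreal[OF exp_ge_zero] exp_sum[OF K, symmetric])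
  qed
  also have "\<dots> = (\<integral>\<^sup>+x. \<integral>\<^sup>+y. (\<Prod>k\<in>K. ennreal (exp (b * (\<Sum>u<n. w u (x u) k) * y k))) \<partial>?G \<partial>?M)"
    by (intro nn_integral_cong PG.product_nn_integral_prod[symmetric] K) simp
  also have "\<dots> = (\<integral>\<^sup>+y. \<integral>\<^sup>+x. (\<Prod>k\<in>K. ennreal (exp (b * (\<Sum>u<n. w u (x u) k) * y k))) \<partial>?M \<partial>?G)"
  proof (rule MG.Fubini'[symmetric])
    show "(\<lambda>(x, y). \<Prod>k\<in>K. ennreal (exp (b * (\<Sum>u<n. w u (x u) k) * y k))) \<in> borel_measurable (?M \<Otimes>\<^sub>M ?G)"
      unfolding case_prod_unfold
      by (intro borel_measurable_prod_ennreal measurable_compose[OF _ measurable_ennreal]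
          borel_measurable_exp[THEN measurable_compose[rotated]] borel_measurable_times borel_measurable_sum
          borel_measurable_const gm wm measurable_fst measurable_snd) auto
  qed
  \<comment> \<open>Exchanging the sums over \<open>k\<close> and \<open>u\<close> in the exponent
    turns a product over \<open>K\<close> into a product over the independent coordinates
    \<open>u\<close>.\<close>
  also have "\<dots> = (\<integral>\<^sup>+y. \<integral>\<^sup>+x. (\<Prod>u<n. ennreal (exp (\<Sum>k\<in>K. w u (x u) k * (b * y k)))) \<partial>?M \<partial>?G)"
  proof -
    have "(\<Sum>k\<in>K. b * (\<Sum>u<n. w u (x u) k) * y k) = (\<Sum>u<n. \<Sum>k\<in>K. w u (x u) k * (b * y k))"
      for x :: "nat \<Rightarrow> 'a" and y
      by (subst sum.swap) (simp add: sum_distrib_left sum_distrib_right mult_ac)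
    then show ?thesis by (simp add: prod_ennreal K flip: exp_sum)
  qed
  also have "\<dots> = (\<integral>\<^sup>+y. (\<Prod>u<n. \<integral>\<^sup>+x. ennreal (exp (\<Sum>k\<in>K. w u x k * (b * y k))) \<partial>\<mu>) \<partial>?G)"
    by (intro nn_integral_cong P.product_nn_integral_prod measurable_compose[OF _ measurable_ennreal]
        borel_measurable_exp[THEN measurable_compose[rotated]] borel_measurable_times borel_measurable_sum
          borel_measurable_const w) auto
  also have "\<dots> \<le> (\<integral>\<^sup>+y. (\<Prod>u<n. ennreal (exp (1/2 * s * (\<Sum>k\<in>K. (b * y k)\<^sup>2)))) \<partial>?G)"
    by (intro nn_integral_mono prod_mono_ennreal sub) simp
  \<comment> \<open>The \<open>n\<close> factors are now equal; their product regroups as a product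
    of functions of the single coordinates \<open>y k\<close>, and the Gaussian integral
    factorizes.\<close>
  also have "\<dots> = (\<integral>\<^sup>+y. (\<Prod>k\<in>K. ennreal (exp (a\<^sup>2 * s * (y k)\<^sup>2 / 2))) \<partial>?G)"
  proof -
    have "real n * (1/2 * s * (\<Sum>k\<in>K. (b * y k)\<^sup>2)) = (\<Sum>k\<in>K. a\<^sup>2 * s * (y k)\<^sup>2 / 2)" for y
      using n by (simp add: power_mult_distrib b2 sum_distrib_left mult_ac)
    then have "exp (1/2 * s * (\<Sum>k\<in>K. (b * y k)\<^sup>2)) ^ n = (\<Prod>k\<in>K. exp (a\<^sup>2 * s * (y k)\<^sup>2 / 2))" for y
      by (simp add: K flip: exp_of_nat_mult exp_sum)
    then show ?thesis by (simp add: prod_ennreal ennreal_power)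
  qed
  also have "\<dots> = (\<Prod>k\<in>K. \<integral>\<^sup>+x. ennreal (exp (a\<^sup>2 * s * x\<^sup>2 / 2)) \<partial>gauss 1)"
    by (intro PG.product_nn_integral_prod K) simp
  also have "\<dots> = (\<integral>\<^sup>+x. ennreal (exp (a\<^sup>2 * s * x\<^sup>2 / 2)) \<partial>gauss 1) ^ card K"
    by simp
  finally show ?thesis .
qed

section \<open>Haar measure under translation, and unitarity of representations\<close>

lemma borel_measurable_continuous_map:
  assumes "haar_measure G T \<mu>" "continuous_map T euclideanreal f"
  shows "f \<in> borel_measurable \<mu>"
proof (rule borel_measurableI)
  fix S :: "real set" assume "open S"
  then have "openin T {x \<in> topspace T. f x \<in> S}"
    by (intro openin_continuous_map_preimage[OF assms(2)]) simp
  moreover have "f -` S \<inter> space \<mu> = {x \<in> topspace T. f x \<in> S}"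
    using assms(1) by (auto simp: haar_measure_def)
  ultimately show "f -` S \<inter> space \<mu> \<in> sets \<mu>"
    using assms(1) by (auto simp: haar_measure_def)
qed

context compact_group
begin

lemma space_haar: "haar_measure G T \<mu> \<Longrightarrow> space \<mu> = carrier G"
  by (simp add: haar_measure_def topspace_eq)

lemma measurable_translation:
  assumes "haar_measure G T \<mu>" "a \<in> carrier G"
  shows "(\<lambda>x. a \<otimes> x) \<in> measurable \<mu> \<mu>"
proof (rule measurable_sigma_sets)
  show "sets \<mu> = sigma_sets (topspace T) {U. openin T U}"
    using assms by (simp add: haar_measure_def)
  show "{U. openin T U} \<subseteq> Pow (topspace T)" by (auto dest: openin_subset)
  show "(\<lambda>x. a \<otimes> x) \<in> space \<mu> \<rightarrow> topspace T"
    using assms by (auto simp: space_haar topspace_eq)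
  have "continuous_map T (prod_topology T T) (\<lambda>x. (a, x))"
    using assms by (intro continuous_map_pairedI) (auto simp: topspace_eq)
  from continuous_map_compose[OF this continuous_mult]
  have c: "continuous_map T T (\<lambda>x. a \<otimes> x)" by (simp add: o_def)
  fix U assume "U \<in> {U. openin T U}"
  then have "openin T {x \<in> topspace T. a \<otimes> x \<in> U}"
    by (intro openin_continuous_map_preimage[OF c]) simp
  moreover have "(\<lambda>x. a \<otimes> x) -` U \<inter> space \<mu> = {x \<in> topspace T. a \<otimes> x \<in> U}"
    using assms by (auto simp: haar_measure_def)
  ultimately show "(\<lambda>x. a \<otimes> x) -` U \<inter> space \<mu> \<in> sets \<mu>"
    using assms(1) by (auto simp: haar_measure_def)
qed

text \<open>The preimage of a set under translation by \<open>a\<close> is its image under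
  translation by \<open>inv a\<close>, and \<open>haar_measure\<close> states invariance for
  images.\<close>

lemma distr_translation:
  assumes h: "haar_measure G T \<mu>" and a: "a \<in> carrier G"
  shows "distr \<mu> \<mu> (\<lambda>x. a \<otimes> x) = \<mu>"
proof (rule measure_eqI)
  fix A assume "A \<in> sets (distr \<mu> \<mu> (\<lambda>x. a \<otimes> x))"
  then have A: "A \<in> sets \<mu>" by simp
  then have Ac: "A \<subseteq> carrier G" using sets.sets_into_space space_haar[OF h] by auto
  have "(\<lambda>x. a \<otimes> x) -` A \<inter> space \<mu> = (\<lambda>x. inv a \<otimes> x) ` A"
  proof (intro equalityI subsetI)
    fix x assume "x \<in> (\<lambda>x. a \<otimes> x) -` A \<inter> space \<mu>"
    then show "x \<in> (\<lambda>x. inv a \<otimes> x) ` A"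
      using a by (intro image_eqI[of _ _ "a \<otimes> x"]) (auto simp: space_haar[OF h] m_assoc[symmetric])
  next
    fix x assume "x \<in> (\<lambda>x. inv a \<otimes> x) ` A"
    then show "x \<in> (\<lambda>x. a \<otimes> x) -` A \<inter> space \<mu>"
      using a Ac by (auto simp: space_haar[OF h] m_assoc[symmetric])
  qed
  then show "emeasure (distr \<mu> \<mu> (\<lambda>x. a \<otimes> x)) A = emeasure \<mu> A"
    using h a A by (simp add: emeasure_distr[OF measurable_translation[OF h a]] haar_measure_def)
qed simp

lemma unitary_rep_inv_mult:
  assumes "unitary_rep G T \<rho>" "g \<in> carrier G" "h \<in> carrier G" "k < rep_dim \<rho>" "l < rep_dim \<rho>"
  shows "(\<Sum>i<rep_dim \<rho>. qcnj (rep_mat \<rho> g $$ (i, k)) * rep_mat \<rho> h $$ (i, l)) = rep_mat \<rho> (inv g \<otimes> h) $$ (k, l)"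
proof -
  let ?d = "rep_dim \<rho>"
  have c [simp]: "rep_mat \<rho> x \<in> carrier_mat ?d ?d" if "x \<in> carrier G" for x
    using assms(1) that by (simp add: unitary_rep_def Let_def)
  have cq: "qadjoint (rep_mat \<rho> g) \<in> carrier_mat ?d ?d"
    using c[OF assms(2)] by (simp add: qadjoint_def)
  \<comment> \<open>Splitting \<open>h\<close> in this way lets unitarity cancel
    \<open>rep_mat \<rho> g\<close> directly, without first identifying its adjoint with the matrix
    of \<open>inv g\<close>.\<close>
  have "rep_mat \<rho> h = rep_mat \<rho> (g \<otimes> (inv g \<otimes> h))"
    using assms by (simp add: m_assoc[symmetric])
  also have "\<dots> = rep_mat \<rho> g * rep_mat \<rho> (inv g \<otimes> h)"
    using assms by (simp add: unitary_rep_def Let_def)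
  finally have "qadjoint (rep_mat \<rho> g) * rep_mat \<rho> h
      = (qadjoint (rep_mat \<rho> g) * rep_mat \<rho> g) * rep_mat \<rho> (inv g \<otimes> h)"
    using assms cq by (subst assoc_mult_mat[of _ ?d ?d _ ?d _ ?d]) auto
  also have "\<dots> = rep_mat \<rho> (inv g \<otimes> h)"
    using assms c[of "inv g \<otimes> h"] by (simp add: unitary_rep_def Let_def left_mult_one_mat[of _ ?d ?d] del: c)
  finally have eq: "qadjoint (rep_mat \<rho> g) * rep_mat \<rho> h = rep_mat \<rho> (inv g \<otimes> h)" .
  have "(\<Sum>i<?d. qcnj (rep_mat \<rho> g $$ (i, k)) * rep_mat \<rho> h $$ (i, l)) = (qadjoint (rep_mat \<rho> g) * rep_mat \<rho> h) $$ (k, l)"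
    using assms(4,5) c[OF assms(2)] c[OF assms(3)] cq
    by (auto simp: scalar_prod_def qadjoint_def lessThan_atLeast0 intro!: sum.cong)
  then show ?thesis by (simp add: eq)
qed

end

section \<open>Entries of the stacked matrix and of its Gram matrix\<close>

text \<open>The entries as a function on all indices, the form in which
  \<open>qre_gram_inner\<close> takes its matrices; row \<open>i\<close> lies in the block of the
  group element \<open>g (i div rep_dim \<rho>)\<close>.\<close>

definition stacked_entry :: "'g rep \<Rightarrow> (nat \<Rightarrow> 'g) \<Rightarrow> nat \<Rightarrow> nat \<Rightarrow> quat" where
  "stacked_entry \<rho> g i k = rep_mat \<rho> (g (i div rep_dim \<rho>)) $$ (i mod rep_dim \<rho>, k)"

definition gram_entry :: "'g rep \<Rightarrow> (nat \<Rightarrow> 'g) \<Rightarrow> nat \<Rightarrow> nat \<Rightarrow> quat" where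
  "gram_entry \<rho> g i j = (\<Sum>k<rep_dim \<rho>. stacked_entry \<rho> g i k * qcnj (stacked_entry \<rho> g j k))"

lemma index_stacked_gram:
  assumes "i < n * rep_dim \<rho>" "j < n * rep_dim \<rho>"
  shows "(stacked n \<rho> g * qadjoint (stacked n \<rho> g)) $$ (i, j) = gram_entry \<rho> g i j"
  using assms
  by (auto simp: stacked_def qadjoint_def Let_def scalar_prod_def gram_entry_def stacked_entry_def
      lessThan_atLeast0 intro!: sum.cong)

lemma gram_entry_qcnj: "gram_entry \<rho> g j i = qcnj (gram_entry \<rho> g i j)"
  by (simp add: gram_entry_def qcnj_sum qcnj_mult)

context compact_group
begin

lemma rep_mat_type_algebra:
  assumes "unitary_rep G T \<rho>" "x \<in> carrier G" "i < rep_dim \<rho>" "j < rep_dim \<rho>"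
  shows "rep_mat \<rho> x $$ (i, j) \<in> type_algebra (rep_type \<rho>)"
proof -
  have c: "rep_mat \<rho> x \<in> carrier_mat (rep_dim \<rho>) (rep_dim \<rho>)"
    and "elements_mat (rep_mat \<rho> x) \<subseteq> type_algebra (rep_type \<rho>)"
    using assms by (auto simp: unitary_rep_def Let_def)
  moreover have "rep_mat \<rho> x $$ (i, j) \<in> elements_mat (rep_mat \<rho> x)"
    using c assms(3,4) by (intro elements_matI) auto
  ultimately show ?thesis by blast
qed

lemma gram_entry_type_algebra:
  assumes "unitary_rep G T \<rho>" "\<And>u. u < n \<Longrightarrow> g u \<in> carrier G"
    and "i < n * rep_dim \<rho>" "j < n * rep_dim \<rho>"
  shows "gram_entry \<rho> g i j \<in> type_algebra (rep_type \<rho>)"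
proof -
  have d: "rep_dim \<rho> > 0" using assms(3) by (cases "rep_dim \<rho>") auto
  have "i div rep_dim \<rho> < n" "j div rep_dim \<rho> < n"
    using assms(3,4) by (simp_all add: less_mult_imp_div_less)
  with d show ?thesis
    unfolding gram_entry_def stacked_entry_def
    by (intro type_algebra_sum type_algebra_mult type_algebra_qcnj rep_mat_type_algebra assms) auto
qed

text \<open>\<open>sum_ensemble_index\<close> turns the weighted sum into a Frobenius inner product
  of two Gram matrices, and \<open>qre_gram_inner\<close> turns that into the squared norm of
  \<open>E\<close>, the product of the adjoint of one stacked matrix with the other. By unitarity
  \<open>E\<close> is a sum of representation matrices.\<close>

lemma sum_ensemble_gram:
  assumes rep: "unitary_rep G T \<rho>" and d: "rep_dim \<rho> > 0"
    and g: "\<And>u. u < n \<Longrightarrow> g u \<in> carrier G" and h: "\<And>u. u < n \<Longrightarrow> h u \<in> carrier G"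
  shows "(\<Sum>x\<in>ensemble_index (rep_type \<rho>) (n * rep_dim \<rho>).
      (\<lambda>(i, j, c). qcomp c (gram_entry \<rho> g i j) * qcomp c (gram_entry \<rho> h i j)) x / ensemble_variance (rep_type \<rho>) x)
    = real (rbeta (rep_type \<rho>)) / 2 * (\<Sum>(k, l, c)\<in>{..<rep_dim \<rho>} \<times> {..<rep_dim \<rho>} \<times> {..<rbeta (rep_type \<rho>)}.
        (\<Sum>u<n. qcomp c (rep_mat \<rho> (inv (g u) \<otimes> h u) $$ (k, l)))\<^sup>2)" (is "?L = ?R")
proof -
  let ?d = "rep_dim \<rho>" and ?t = "rep_type \<rho>"
  define E where "E k l = (\<Sum>i<n * ?d. qcnj (stacked_entry \<rho> g i k) * stacked_entry \<rho> h i l)" for k l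
  have E: "E k l = (\<Sum>u<n. rep_mat \<rho> (inv (g u) \<otimes> h u) $$ (k, l))" if "k < ?d" "l < ?d" for k l
  proof -
    \<comment> \<open>The sum over all rows is split into \<open>n\<close> consecutive blocks of
      length \<open>rep_dim \<rho>\<close>, one for each group element.\<close>
    have "E k l = (\<Sum>u<n. \<Sum>i\<in>{u * ?d..<u * ?d + ?d}. qcnj (stacked_entry \<rho> g i k) * stacked_entry \<rho> h i l)"
      unfolding E_def by (rule sum.nat_group[symmetric])
    also have "\<dots> = (\<Sum>u<n. \<Sum>i<?d. qcnj (rep_mat \<rho> (g u) $$ (i, k)) * rep_mat \<rho> (h u) $$ (i, l))"
    proof (rule sum.cong[OF refl])
      fix u
      have "i div ?d = u \<and> i mod ?d = i - u * ?d" if i: "u * ?d \<le> i" "i < u * ?d + ?d" for i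
      proof -
        from i obtain j where "i = u * ?d + j" "j < ?d" by (metis le_iff_add nat_add_left_cancel_less)
        then show ?thesis by simp
      qed
      then show "(\<Sum>i\<in>{u * ?d..<u * ?d + ?d}. qcnj (stacked_entry \<rho> g i k) * stacked_entry \<rho> h i l)
        = (\<Sum>i<?d. qcnj (rep_mat \<rho> (g u) $$ (i, k)) * rep_mat \<rho> (h u) $$ (i, l))"
        by (intro sum.reindex_bij_witness[of _ "\<lambda>i. i + u * ?d" "\<lambda>i. i - u * ?d"])
          (auto simp: stacked_entry_def)
    qed
    also have "\<dots> = (\<Sum>u<n. rep_mat \<rho> (inv (g u) \<otimes> h u) $$ (k, l))"
      using that by (intro sum.cong refl unitary_rep_inv_mult rep g h) auto
    finally show ?thesis .
  qed
  have "?L = real (rbeta ?t) / 2 * (\<Sum>i<n * ?d. \<Sum>j<n * ?d. qre (gram_entry \<rho> g i j * qcnj (gram_entry \<rho> h i j)))"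
    by (intro sum_ensemble_index conjI gram_entry_type_algebra[OF rep] gram_entry_qcnj g h) auto
  also have "\<dots> = real (rbeta ?t) / 2 * (\<Sum>k<?d. \<Sum>l<?d. qre (E k l * qcnj (E k l)))"
    unfolding gram_entry_def E_def by (subst qre_gram_inner) simp
  also have "\<dots> = real (rbeta ?t) / 2 * (\<Sum>k<?d. \<Sum>l<?d. \<Sum>c<rbeta ?t. (qcomp c (E k l))\<^sup>2)"
  proof -
    \<comment> \<open>As \<open>E k l\<close> is a sum of entries of representation matrices, it
      stays in the subalgebra of the type, and only its first \<open>rbeta\<close> components
      contribute.\<close>
    have "qre (E k l * qcnj (E k l)) = (\<Sum>c<rbeta ?t. (qcomp c (E k l))\<^sup>2)" if "k < ?d" "l < ?d" for k l
    proof -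
      have "E k l \<in> type_algebra ?t"
        unfolding E[OF that] using that
        by (intro type_algebra_sum rep_mat_type_algebra rep) (auto simp: g h)
      then show ?thesis
        unfolding qre_mult_qcnj power2_eq_square using rbeta_le_4[of ?t]
        by (intro sum.mono_neutral_right) (auto simp: type_algebra_def)
    qed
    then show ?thesis by simp
  qed
  also have "\<dots> = ?R"
    by (simp add: E qcomp_sum sum.cartesian_product case_prod_unfold)
  finally show ?thesis .
qed

end

section \<open>The synchronization model\<close>

text \<open>Componentwise measurability matches the sigma-algebra of \<open>mat_space\<close>.
  Letting \<open>c\<close> range over all naturals is harmless, as \<open>qcomp c\<close> vanishes
  from 4 onwards.\<close>

definition quat_measurable :: "'a measure \<Rightarrow> ('a \<Rightarrow> quat) \<Rightarrow> bool" where
  "quat_measurable M f \<longleftrightarrow> (\<forall>c. (\<lambda>x. qcomp c (f x)) \<in> borel_measurable M)"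

lemma quat_measurable_sum:
  "(\<And>i. i \<in> A \<Longrightarrow> quat_measurable M (f i)) \<Longrightarrow> quat_measurable M (\<lambda>x. \<Sum>i\<in>A. f i x)"
  unfolding quat_measurable_def qcomp_sum by (intro allI borel_measurable_sum) blast

lemma quat_measurable_qcnj: "quat_measurable M f \<Longrightarrow> quat_measurable M (\<lambda>x. qcnj (f x))"
  unfolding quat_measurable_def qcomp_qcnj by (intro allI borel_measurable_times borel_measurable_const) blast

lemma quat_measurable_iff:
  "quat_measurable M f \<longleftrightarrow> (\<lambda>x. qre (f x)) \<in> borel_measurable M \<and> (\<lambda>x. qi (f x)) \<in> borel_measurable M \<and>
    (\<lambda>x. qj (f x)) \<in> borel_measurable M \<and> (\<lambda>x. qk (f x)) \<in> borel_measurable M" (is "_ \<longleftrightarrow> ?R")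
proof
  assume "quat_measurable M f"
  then have "(\<lambda>x. qcomp c (f x)) \<in> borel_measurable M" for c by (simp add: quat_measurable_def)
  from this[of 0] this[of 1] this[of 2] this[of 3] show ?R by (simp add: qcomp_def)
next
  assume ?R
  then have "(\<lambda>x. qcomp c (f x)) \<in> borel_measurable M" for c
    by (cases "c = 0"; cases "c = 1"; cases "c = 2"; cases "c = 3"; simp add: qcomp_def)
  then show "quat_measurable M f" by (simp add: quat_measurable_def)
qed

lemma quat_measurable_mult:
  "quat_measurable M f \<Longrightarrow> quat_measurable M g \<Longrightarrow> quat_measurable M (\<lambda>x. f x * g x)"
  unfolding quat_measurable_iff quat_sel
  by (intro conjI borel_measurable_add borel_measurable_diff borel_measurable_times) blast+

lemma quat_measurable_compose:
  "quat_measurable N f \<Longrightarrow> g \<in> measurable M N \<Longrightarrow> quat_measurable M (\<lambda>x. f (g x))"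
  by (auto simp: quat_measurable_def intro: measurable_compose)

lemma space_mat_space [simp]: "space (mat_space N) = carrier_mat N N"
  by (simp add: mat_space_def)

lemma mat_space_entry:
  assumes "i < N" "j < N"
  shows "quat_measurable (mat_space N) (\<lambda>A. A $$ (i, j))"
proof -
  have "(\<lambda>A. qcomp c (A $$ (i, j))) \<in> borel_measurable (mat_space N)" for c
  proof (cases "c < 4")
    case True
    let ?I = "{..<N} \<times> {..<N} \<times> {..<4::nat}"
    have "(\<lambda>A. \<lambda>(i, j, c)\<in>?I. qcomp c (A $$ (i, j))) \<in> measurable (mat_space N) (PiM ?I (\<lambda>_. borel))"
      unfolding mat_space_def by (intro measurable_vimage_algebra1) (auto simp: space_PiM)
    moreover have "(\<lambda>x. x (i, j, c)) \<in> measurable (PiM ?I (\<lambda>_. borel)) (borel :: real measure)"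
      using True assms by (intro measurable_component_singleton) auto
    ultimately have "(\<lambda>A. (\<lambda>(i, j, c)\<in>?I. qcomp c (A $$ (i, j))) (i, j, c)) \<in> borel_measurable (mat_space N)"
      by (rule measurable_compose)
    then show ?thesis using True assms by simp
  qed (simp add: qcomp_def)
  then show ?thesis by (simp add: quat_measurable_def)
qed

lemma measurable_mat_space:
  assumes "\<And>x. x \<in> space M \<Longrightarrow> f x \<in> carrier_mat N N"
    and "\<And>i j. i < N \<Longrightarrow> j < N \<Longrightarrow> quat_measurable M (\<lambda>x. f x $$ (i, j))"
  shows "f \<in> measurable M (mat_space N)"
  unfolding mat_space_def
proof (rule measurable_vimage_algebra2)
  show "f \<in> space M \<rightarrow> carrier_mat N N" using assms(1) by auto
  show "(\<lambda>x. \<lambda>(i, j, c)\<in>{..<N} \<times> {..<N} \<times> {..<4}. qcomp c (f x $$ (i, j)))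
      \<in> measurable M (PiM ({..<N} \<times> {..<N} \<times> {..<4}) (\<lambda>_. borel))"
    using assms(2) by (intro measurable_restrict) (auto simp: quat_measurable_def)
qed

lemma qcomp_Quat: "c < 4 \<Longrightarrow> qcomp c (Quat (f 0) (f 1) (f 2) (f 3)) = f c"
  by (auto simp: qcomp_def numeral_eq_Suc less_Suc_eq)

lemma qcomp_hermitian_mat:
  assumes "i < N" "j < N" "c < 4"
  shows "qcomp c (hermitian_mat t N \<xi> $$ (i, j)) =
    (if i \<le> j then if (i, j, c) \<in> ensemble_index t N then \<xi> (i, j, c) else 0
     else (if c = 0 then 1 else - 1) * (if (j, i, c) \<in> ensemble_index t N then \<xi> (j, i, c) else 0))"
proof -
  define x where "x i j c = (if (i, j, c) \<in> ensemble_index t N then \<xi> (i, j, c) else 0)" for i j c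
  have "hermitian_mat t N \<xi> $$ (i, j) =
    (if i \<le> j then Quat (x i j 0) (x i j 1) (x i j 2) (x i j 3)
     else qcnj (Quat (x j i 0) (x j i 1) (x j i 2) (x j i 3)))"
    using assms(1,2) by (simp only: hermitian_mat_def Let_def x_def index_mat prod.case)
  then show ?thesis
    by (simp only: qcomp_qcnj qcomp_Quat[OF assms(3), of "x i j"] qcomp_Quat[OF assms(3), of "x j i"]
        if_distrib[of "qcomp c"]) (simp only: x_def)
qed

lemma hermitian_mat_carrier [simp]: "hermitian_mat t N \<xi> \<in> carrier_mat N N"
  by (simp add: hermitian_mat_def Let_def)

lemma ensemble_components_eq:
  "ensemble_components t N = PiM (ensemble_index t N) (\<lambda>x. gauss (ensemble_variance t x))"
  unfolding ensemble_components_def ensemble_variance_def by (intro PiM_cong) auto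

lemma ensemble_variance_pos: "ensemble_variance t x > 0"
  by (cases x) (simp add: ensemble_variance_def)

lemma prob_space_ensemble_components: "prob_space (ensemble_components t N)"
  unfolding ensemble_components_eq by (intro prob_space_PiM prob_space_gauss ensemble_variance_pos)

lemma measurable_hermitian_mat: "hermitian_mat t N \<in> measurable (ensemble_components t N) (mat_space N)"
proof (rule measurable_mat_space)
  fix i j assume ij: "i < N" "j < N"
  have *: "(\<lambda>\<xi>. if x \<in> ensemble_index t N then \<xi> x else 0) \<in> borel_measurable (ensemble_components t N)" for x
  proof (cases "x \<in> ensemble_index t N")
    case True
    then have "(\<lambda>\<xi>. \<xi> x) \<in> measurable (ensemble_components t N) (gauss (ensemble_variance t x))"
      unfolding ensemble_components_eq by (rule measurable_component_singleton)
    with True show ?thesis by (simp add: measurable_cong_sets[OF refl sets_gauss])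
  qed simp
  have "(\<lambda>\<xi>. qcomp c (hermitian_mat t N \<xi> $$ (i, j))) \<in> borel_measurable (ensemble_components t N)" for c
  proof (cases "c < 4")
    case True
    show ?thesis
      unfolding qcomp_hermitian_mat[OF ij True]
      by (cases "i \<le> j"; simp only: if_True if_False; intro borel_measurable_times borel_measurable_const *)
  qed (simp add: qcomp_def)
  then show "quat_measurable (ensemble_components t N) (\<lambda>\<xi>. hermitian_mat t N \<xi> $$ (i, j))"
    by (simp add: quat_measurable_def)
qed simp

lemma sets_gaussian_ensemble [simp]: "sets (gaussian_ensemble t N) = sets (mat_space N)"
  by (simp add: gaussian_ensemble_def)

text \<open>The scalars are real, so taking components commutes with them. This reduces both the
  measurability of the observation and its rewriting as shifted noise to statements about real
  numbers.\<close>

lemma qcomp_observation: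
  assumes "W \<in> carrier_mat (n * rep_dim \<rho>) (n * rep_dim \<rho>)" "i < n * rep_dim \<rho>" "j < n * rep_dim \<rho>"
  shows "qcomp c (observation n l \<rho> g W $$ (i, j)) =
    l / real n * qcomp c (gram_entry \<rho> g i j) + 1 / sqrt (real (n * rep_dim \<rho>)) * qcomp c (W $$ (i, j))"
proof -
  have d: "dim_row (stacked n \<rho> g) = n * rep_dim \<rho>" "dim_col (qadjoint (stacked n \<rho> g)) = n * rep_dim \<rho>"
    by (simp_all add: stacked_def qadjoint_def Let_def)
  have of: "of_real r * q = r *\<^sub>R q" for r and q :: quat by (simp add: scaleR_conv_of_real)
  have "observation n l \<rho> g W $$ (i, j) =
      of_real (l / real n) * (stacked n \<rho> g * qadjoint (stacked n \<rho> g)) $$ (i, j) +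
      of_real (1 / sqrt (real (n * rep_dim \<rho>))) * W $$ (i, j)"
    using assms d by (simp add: observation_def del: of_real_divide index_mult_mat(1))
  also have "\<dots> = (l / real n) *\<^sub>R gram_entry \<rho> g i j + (1 / sqrt (real (n * rep_dim \<rho>))) *\<^sub>R W $$ (i, j)"
    by (simp only: index_stacked_gram[OF assms(2,3)] of)
  finally show ?thesis by (simp only: qcomp_add qcomp_scaleR)
qed

lemma observation_carrier:
  "W \<in> carrier_mat (n * rep_dim \<rho>) (n * rep_dim \<rho>) \<Longrightarrow>
    observation n l \<rho> g W \<in> carrier_mat (n * rep_dim \<rho>) (n * rep_dim \<rho>)"
  by (simp add: observation_def)

section \<open>The model as an image of Haar measure and independent Gaussian components\<close>

locale synchronization = compact_group G T for G :: "('g, 'm) monoid_scheme" (structure) and T +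
  fixes \<mu> :: "'g measure" and \<Psi> :: "'g rep set"
  assumes haar: "haar_measure G T \<mu>"
    and finite_freq: "finite \<Psi>"
    and rep: "\<And>\<rho>. \<rho> \<in> \<Psi> \<Longrightarrow> unitary_rep G T \<rho>"
    and rep_dim_pos: "\<And>\<rho>. \<rho> \<in> \<Psi> \<Longrightarrow> rep_dim \<rho> > 0"
begin

abbreviation "haar_product n \<equiv> PiM {..<n::nat} (\<lambda>_. \<mu>)"
abbreviation "obs_space n \<equiv> PiM \<Psi> (\<lambda>\<rho>. mat_space (n * rep_dim \<rho>))"
abbreviation "noise_index n \<equiv> (\<lambda>\<rho>. ensemble_index (rep_type \<rho>) (n * rep_dim \<rho>))"
abbreviation "noise_variance \<equiv> (\<lambda>\<rho>. ensemble_variance (rep_type \<rho>))"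
abbreviation "noise n \<equiv> gauss_product \<Psi> (noise_index n) noise_variance"

sublocale noise: gauss_family \<Psi> "noise_index n" noise_variance for n
  by unfold_locales (auto simp: finite_freq finite_ensemble_index ensemble_variance_pos)

lemma prob_space_haar: "prob_space \<mu>"
  using haar by (simp add: haar_measure_def)

lemma prob_space_haar_product: "prob_space (haar_product n)"
  by (intro prob_space_PiM prob_space_haar)

lemma haar_product_carrier: "g \<in> space (haar_product n) \<Longrightarrow> u < n \<Longrightarrow> g u \<in> carrier G"
  by (auto simp: space_PiM space_haar[OF haar])

lemma quat_measurable_rep_mat:
  assumes "\<rho> \<in> \<Psi>" "i < rep_dim \<rho>" "j < rep_dim \<rho>"
  shows "quat_measurable \<mu> (\<lambda>x. rep_mat \<rho> x $$ (i, j))"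
proof -
  have "(\<lambda>x. qcomp c (rep_mat \<rho> x $$ (i, j))) \<in> borel_measurable \<mu>" for c
  proof (cases "c < 4")
    case True
    with rep[OF assms(1)] assms(2,3)
    have "continuous_map T euclideanreal (\<lambda>x. qcomp c (rep_mat \<rho> x $$ (i, j)))"
      by (simp add: unitary_rep_def Let_def)
    then show ?thesis by (rule borel_measurable_continuous_map[OF haar])
  qed (simp add: qcomp_def)
  then show ?thesis by (simp add: quat_measurable_def)
qed

lemma quat_measurable_gram_entry:
  assumes "\<rho> \<in> \<Psi>" "i < n * rep_dim \<rho>" "j < n * rep_dim \<rho>"
  shows "quat_measurable (haar_product n) (\<lambda>g. gram_entry \<rho> g i j)"
proof -
  have "quat_measurable (haar_product n) (\<lambda>g. stacked_entry \<rho> g i k)"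
    if "i < n * rep_dim \<rho>" "k < rep_dim \<rho>" for i k
  proof -
    have "(\<lambda>g. g (i div rep_dim \<rho>)) \<in> measurable (haar_product n) \<mu>"
      using that by (intro measurable_component_singleton) (simp add: less_mult_imp_div_less)
    moreover have "quat_measurable \<mu> (\<lambda>x. rep_mat \<rho> x $$ (i mod rep_dim \<rho>, k))"
      using that rep_dim_pos[OF assms(1)] by (intro quat_measurable_rep_mat assms(1)) auto
    ultimately show ?thesis
      unfolding stacked_entry_def
      by (rule quat_measurable_compose[of \<mu> "\<lambda>x. rep_mat \<rho> x $$ (i mod rep_dim \<rho>, k)", rotated])
  qed
  then show ?thesis
    unfolding gram_entry_def using assms
    by (intro quat_measurable_sum quat_measurable_mult quat_measurable_qcnj) auto
qed

lemma measurable_observation: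
  "(\<lambda>(g, W). \<lambda>\<rho>\<in>\<Psi>. observation n (lam \<rho>) \<rho> g (W \<rho>)) \<in> measurable (haar_product n \<Otimes>\<^sub>M obs_space n) (obs_space n)"
  unfolding case_prod_unfold
proof (intro measurable_restrict measurable_mat_space)
  fix \<rho> assume \<rho>: "\<rho> \<in> \<Psi>"
  let ?N = "n * rep_dim \<rho>"
  have Wm: "(\<lambda>W. W \<rho>) \<in> measurable (obs_space n) (mat_space ?N)"
    using \<rho> by (rule measurable_component_singleton)
  have W: "snd z \<rho> \<in> carrier_mat ?N ?N" if "z \<in> space (haar_product n \<Otimes>\<^sub>M obs_space n)" for z
    using measurable_space[OF measurable_compose[OF measurable_snd Wm] that] by simp
  then show "observation n (lam \<rho>) \<rho> (fst z) (snd z \<rho>) \<in> carrier_mat ?N ?N"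
    if "z \<in> space (haar_product n \<Otimes>\<^sub>M obs_space n)" for z
    using that by (intro observation_carrier)
  fix i j assume ij: "i < ?N" "j < ?N"
  let ?M = "haar_product n \<Otimes>\<^sub>M obs_space n"
  have "quat_measurable ?M (\<lambda>z. gram_entry \<rho> (fst z) i j)"
    by (rule quat_measurable_compose[OF quat_measurable_gram_entry[OF \<rho> ij] measurable_fst])
  moreover have "quat_measurable ?M (\<lambda>z. snd z \<rho> $$ (i, j))"
    by (rule quat_measurable_compose[OF mat_space_entry[OF ij] measurable_compose[OF measurable_snd Wm]])
  ultimately have "(\<lambda>z. lam \<rho> / real n * qcomp c (gram_entry \<rho> (fst z) i j) +
      1 / sqrt (real ?N) * qcomp c (snd z \<rho> $$ (i, j))) \<in> borel_measurable ?M" for c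
    unfolding quat_measurable_def
    by (intro borel_measurable_add borel_measurable_times borel_measurable_const) simp_all
  then have "(\<lambda>z. qcomp c (observation n (lam \<rho>) \<rho> (fst z) (snd z \<rho>) $$ (i, j))) \<in> borel_measurable ?M" for c
    by (rule measurable_cong[THEN iffD2, rotated]) (rule qcomp_observation[OF W ij])
  then show "quat_measurable ?M (\<lambda>z. observation n (lam \<rho>) \<rho> (fst z) (snd z \<rho>) $$ (i, j))"
    by (simp add: quat_measurable_def)
qed

text \<open>Each noise matrix is an image of its independent components. Pulling these maps out of
  the product over \<Psi> and out of the pair with the group elements brings the model to the form
  treated by \<open>gauss_family\<close>.\<close>

lemma GSynch_eq:
  "GSynch n lam \<mu> \<Psi> = distr (haar_product n \<Otimes>\<^sub>M noise n) (obs_space n)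
    (\<lambda>(g, \<xi>). \<lambda>\<rho>\<in>\<Psi>. observation n (lam \<rho>) \<rho> g (hermitian_mat (rep_type \<rho>) (n * rep_dim \<rho>) (\<xi> \<rho>)))"
  and prob_space_GSynch: "prob_space (GSynch n lam \<mu> \<Psi>)"
proof -
  let ?E = "PiM \<Psi> (\<lambda>\<rho>. gaussian_ensemble (rep_type \<rho>) (n * rep_dim \<rho>))"
  define H where "H \<xi> = (\<lambda>\<rho>\<in>\<Psi>. hermitian_mat (rep_type \<rho>) (n * rep_dim \<rho>) (\<xi> \<rho>))"
    for \<xi> :: "'g rep \<Rightarrow> nat \<times> nat \<times> nat \<Rightarrow> real"
  let ?o = "\<lambda>(g, W). \<lambda>\<rho>\<in>\<Psi>. observation n (lam \<rho>) \<rho> g (W \<rho>)"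
  have N: "noise n = PiM \<Psi> (\<lambda>\<rho>. ensemble_components (rep_type \<rho>) (n * rep_dim \<rho>))"
    by (simp add: gauss_product_def ensemble_components_eq)
  have H: "H \<in> measurable (noise n) (obs_space n)"
    unfolding N H_def
    by (intro measurable_restrict measurable_compose[OF _ measurable_hermitian_mat] measurable_component_singleton)
  have E: "?E = distr (noise n) (obs_space n) H"
    unfolding gaussian_ensemble_def N H_def
    by (intro PiM_distr[symmetric] finite_freq prob_space_ensemble_components measurable_hermitian_mat)
  interpret h: prob_space "haar_product n" by (rule prob_space_haar_product)
  interpret N: prob_space "noise n" by (rule noise.prob_space_N)
  interpret E: prob_space "distr (noise n) (obs_space n) H" by (rule N.prob_space_distr[OF H])
  interpret hN: pair_prob_space "haar_product n" "noise n" ..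
  have pm: "(\<lambda>(x, y). (x, H y)) \<in> measurable (haar_product n \<Otimes>\<^sub>M noise n) (haar_product n \<Otimes>\<^sub>M obs_space n)"
    unfolding case_prod_unfold
    by (intro measurable_Pair measurable_fst measurable_compose[OF measurable_snd H])
  have "distr (haar_product n) (haar_product n) (\<lambda>x. x) \<Otimes>\<^sub>M distr (noise n) (obs_space n) H =
      distr (haar_product n \<Otimes>\<^sub>M noise n) (haar_product n \<Otimes>\<^sub>M obs_space n) (\<lambda>(x, y). (x, H y))"
    by (intro pair_measure_distr H E.sigma_finite_measure_axioms) simp
  then have "GSynch n lam \<mu> \<Psi> = distr (distr (haar_product n \<Otimes>\<^sub>M noise n) (haar_product n \<Otimes>\<^sub>M obs_space n) (\<lambda>(x, y). (x, H y))) (obs_space n) ?o"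
    unfolding GSynch_def E by (simp only: distr_id)
  also have "\<dots> = distr (haar_product n \<Otimes>\<^sub>M noise n) (obs_space n) (?o \<circ> (\<lambda>(x, y). (x, H y)))"
    by (rule distr_distr[OF measurable_observation pm])
  also have "?o \<circ> (\<lambda>(x, y). (x, H y)) =
    (\<lambda>(g, \<xi>). \<lambda>\<rho>\<in>\<Psi>. observation n (lam \<rho>) \<rho> g (hermitian_mat (rep_type \<rho>) (n * rep_dim \<rho>) (\<xi> \<rho>)))"
    by (auto simp: H_def fun_eq_iff)
  finally show "GSynch n lam \<mu> \<Psi> = distr (haar_product n \<Otimes>\<^sub>M noise n) (obs_space n)
    (\<lambda>(g, \<xi>). \<lambda>\<rho>\<in>\<Psi>. observation n (lam \<rho>) \<rho> g (hermitian_mat (rep_type \<rho>) (n * rep_dim \<rho>) (\<xi> \<rho>)))" .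
  interpret hE: pair_prob_space "haar_product n" "distr (noise n) (obs_space n) H" ..
  have "?o \<in> measurable (haar_product n \<Otimes>\<^sub>M distr (noise n) (obs_space n) H) (obs_space n)"
    using measurable_observation by (simp cong: measurable_cong_sets)
  then show "prob_space (GSynch n lam \<mu> \<Psi>)"
    unfolding GSynch_def E by (rule hE.prob_space_distr)
qed

text \<open>With these means for the noise components, shifting the noise adds exactly the signal
  \<open>(l / n) X X\<^sup>*\<close> to the observation.\<close>

definition signal_mean :: "nat \<Rightarrow> real \<Rightarrow> (nat \<Rightarrow> 'g) \<Rightarrow> 'g rep \<Rightarrow> nat \<times> nat \<times> nat \<Rightarrow> real" where
  "signal_mean n l g \<rho> = (\<lambda>(i, j, c).
    l / real n * sqrt (real (n * rep_dim \<rho>)) * qcomp c (gram_entry \<rho> g i j))"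

text \<open>The observation at zero signal. Both laws to be compared factor through this one map, so
  events can be pulled back to the Gaussian space \<open>noise n\<close>.\<close>

definition scaled_noise :: "nat \<Rightarrow> ('g rep \<Rightarrow> nat \<times> nat \<times> nat \<Rightarrow> real) \<Rightarrow> 'g rep \<Rightarrow> quat mat" where
  "scaled_noise n \<xi> = (\<lambda>\<rho>\<in>\<Psi>. of_real (1 / sqrt (real (n * rep_dim \<rho>))) \<cdot>\<^sub>m
    hermitian_mat (rep_type \<rho>) (n * rep_dim \<rho>) (\<xi> \<rho>))"

lemma qcomp_scaled_noise:
  assumes "\<rho> \<in> \<Psi>" "i < n * rep_dim \<rho>" "j < n * rep_dim \<rho>"
  shows "qcomp c (scaled_noise n \<xi> \<rho> $$ (i, j)) =
    1 / sqrt (real (n * rep_dim \<rho>)) * qcomp c (hermitian_mat (rep_type \<rho>) (n * rep_dim \<rho>) (\<xi> \<rho>) $$ (i, j))"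
proof -
  have of: "of_real r * q = r *\<^sub>R q" for r and q :: quat by (simp add: scaleR_conv_of_real)
  have "hermitian_mat (rep_type \<rho>) (n * rep_dim \<rho>) (\<xi> \<rho>) \<in> carrier_mat (n * rep_dim \<rho>) (n * rep_dim \<rho>)"
    by simp
  then have "scaled_noise n \<xi> \<rho> $$ (i, j) = of_real (1 / sqrt (real (n * rep_dim \<rho>))) *
      hermitian_mat (rep_type \<rho>) (n * rep_dim \<rho>) (\<xi> \<rho>) $$ (i, j)"
    using assms by (simp add: scaled_noise_def del: of_real_divide hermitian_mat_carrier)
  then show ?thesis by (simp only: of qcomp_scaleR)
qed

text \<open>The factor \<open>sqrt (n d)\<close> in \<open>signal_mean\<close> cancels the scaling
  of the noise. Shifting the components on and above the diagonal suffices, since the signal is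
  Hermitian as well.\<close>

lemma observation_eq_scaled_noise:
  assumes n: "n > 0" and g: "g \<in> space (haar_product n)"
  shows "(\<lambda>\<rho>\<in>\<Psi>. observation n l \<rho> g (hermitian_mat (rep_type \<rho>) (n * rep_dim \<rho>) (\<xi> \<rho>)))
    = scaled_noise n (location_shift \<Psi> (noise_index n) (signal_mean n l g) \<xi>)"
proof
  fix \<rho> :: "'g rep"
  let ?s = "location_shift \<Psi> (noise_index n) (signal_mean n l g) \<xi>"
  let ?N = "n * rep_dim \<rho>" and ?t = "rep_type \<rho>"
  show "(\<lambda>\<rho>\<in>\<Psi>. observation n l \<rho> g (hermitian_mat (rep_type \<rho>) (n * rep_dim \<rho>) (\<xi> \<rho>))) \<rho> = scaled_noise n ?s \<rho>"
  proof (cases "\<rho> \<in> \<Psi>")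
    case True
    have pos: "sqrt (real ?N) > 0" using n rep_dim_pos[OF True] by simp
    have "observation n l \<rho> g (hermitian_mat ?t ?N (\<xi> \<rho>)) = scaled_noise n ?s \<rho>"
    proof (rule eq_matI)
      have c: "observation n l \<rho> g (hermitian_mat ?t ?N (\<xi> \<rho>)) \<in> carrier_mat ?N ?N"
        by (intro observation_carrier hermitian_mat_carrier)
      have c': "scaled_noise n ?s \<rho> \<in> carrier_mat ?N ?N"
        using True by (simp add: scaled_noise_def)
      show "dim_row (observation n l \<rho> g (hermitian_mat ?t ?N (\<xi> \<rho>))) = dim_row (scaled_noise n ?s \<rho>)"
        "dim_col (observation n l \<rho> g (hermitian_mat ?t ?N (\<xi> \<rho>))) = dim_col (scaled_noise n ?s \<rho>)"
        using c c' by (simp_all only: carrier_matD)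
      fix i j assume "i < dim_row (scaled_noise n ?s \<rho>)" "j < dim_col (scaled_noise n ?s \<rho>)"
      then have ij: "i < ?N" "j < ?N" using c' by (simp_all only: carrier_matD)
      show "observation n l \<rho> g (hermitian_mat ?t ?N (\<xi> \<rho>)) $$ (i, j) = scaled_noise n ?s \<rho> $$ (i, j)"
      proof (rule quat_eqI)
        fix c :: nat assume c4: "c < 4"
        have key: "l / real n * qcomp c (gram_entry \<rho> g i j) + 1 / sqrt (real ?N) * (if (i, j, c) \<in> ensemble_index ?t ?N then \<xi> \<rho> (i, j, c) else 0)
          = 1 / sqrt (real ?N) * (if (i, j, c) \<in> ensemble_index ?t ?N then ?s \<rho> (i, j, c) else 0)"
          if ij: "i < ?N" "j < ?N" "i \<le> j" for i j
        proof (cases "(i, j, c) \<in> ensemble_index ?t ?N")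
          case idx: True
          have "?s \<rho> (i, j, c) = l / real n * sqrt (real ?N) * qcomp c (gram_entry \<rho> g i j) + \<xi> \<rho> (i, j, c)"
            using True idx by (simp add: location_shift_def signal_mean_def)
          moreover have "a * q + 1 / s * x = 1 / s * (a * s * q + x)" if "s > 0" for a q s x :: real
            using that by (simp add: field_simps)
          ultimately show ?thesis using idx pos by (simp only: if_True)
        next
          case False
          then have "c \<ge> rbeta ?t \<or> i = j \<and> c \<noteq> 0"
            using ij by (auto simp: ensemble_index_def)
          \<comment> \<open>Components that carry no noise carry no signal either: they lie outside
            the subalgebra of the type or are imaginary parts on the diagonal.\<close>
          then have "qcomp c (gram_entry \<rho> g i j) = 0"
          proof
            assume "c \<ge> rbeta ?t"
            moreover have "gram_entry \<rho> g i j \<in> type_algebra ?t"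
              using gram_entry_type_algebra[OF rep[OF True] haar_product_carrier[OF g] ij(1,2)] .
            ultimately show ?thesis by (simp add: type_algebra_def)
          next
            assume "i = j \<and> c \<noteq> 0"
            then show ?thesis
              using arg_cong[OF gram_entry_qcnj[of \<rho> g i i], of "qcomp c"] by (simp add: qcomp_qcnj)
          qed
          with False show ?thesis by simp
        qed
        show "qcomp c (observation n l \<rho> g (hermitian_mat ?t ?N (\<xi> \<rho>)) $$ (i, j)) = qcomp c (scaled_noise n ?s \<rho> $$ (i, j))"
        proof (cases "i \<le> j")
          case le: True
          then show ?thesis
            unfolding qcomp_observation[OF hermitian_mat_carrier ij] qcomp_scaled_noise[OF True ij]
              qcomp_hermitian_mat[OF ij c4]
            using key[OF ij le] by (simp only: if_True)
        next
          case nle: False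
          then have "j \<le> i" by simp
          \<comment> \<open>The sign by which conjugation acts on component \<open>c\<close>; it
            transports \<open>key\<close> from the mirrored entry \<open>(j, i)\<close> to
            \<open>(i, j)\<close>.\<close>
          define e :: real where "e = (if c = 0 then 1 else - 1)"
          have "qcomp c (gram_entry \<rho> g i j) = e * qcomp c (gram_entry \<rho> g j i)"
            unfolding gram_entry_qcnj[of \<rho> g i j] qcomp_qcnj e_def ..
          moreover note key[OF ij(2,1) \<open>j \<le> i\<close>, THEN arg_cong[where f = "\<lambda>x. e * x"]]
          ultimately show ?thesis
            unfolding qcomp_observation[OF hermitian_mat_carrier ij] qcomp_scaled_noise[OF True ij]
              qcomp_hermitian_mat[OF ij c4] e_def[symmetric]
            using nle by (simp only: if_False distrib_left mult.left_commute[of e])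
        qed
      qed
    qed
    with True show ?thesis by simp
  qed (simp add: scaled_noise_def)
qed

section \<open>The overlap of two signals in terms of \<open>Z_vec\<close>, and the second
  moment\<close>

lemma finite_Z_index: "finite (Z_index \<Psi>)"
  by (simp add: Z_index_def finite_freq)

lemma measurable_Z_vec:
  assumes "z \<in> Z_index \<Psi>"
  shows "(\<lambda>x. Z_vec x z) \<in> borel_measurable \<mu>"
proof -
  obtain \<rho> i j c where z: "z = (\<rho>, i, j, c)" by (cases z)
  with assms have "quat_measurable \<mu> (\<lambda>x. rep_mat \<rho> x $$ (i, j))"
    by (intro quat_measurable_rep_mat) (auto simp: Z_index_def)
  then show ?thesis
    unfolding z Z_vec_def prod.case quat_measurable_def
    by (intro borel_measurable_times borel_measurable_const) blast
qed

text \<open>The constants match: the squared weight of the mean is \<open>l^2 d / n\<close>, and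
  with the factor \<beta> \<open>/ 2\<close> from \<open>sum_ensemble_gram\<close> it becomes
  \<open>l^2 / 2\<close> times \<beta> \<open>d / n\<close>, where \<beta> \<open>d\<close> is the
  square of the normalization in \<open>Z_vec\<close>.\<close>

lemma sum_signal_mean:
  assumes n: "n > 0" and g: "g \<in> space (haar_product n)" and h: "h \<in> space (haar_product n)"
  shows "(\<Sum>\<rho>\<in>\<Psi>. \<Sum>x\<in>noise_index n \<rho>. signal_mean n l g \<rho> x * signal_mean n l h \<rho> x / noise_variance \<rho> x)
    = l\<^sup>2 / 2 * (\<Sum>z\<in>Z_index \<Psi>. (\<Sum>u<n. Z_vec (inv (g u) \<otimes> h u) z)\<^sup>2 / real n)" (is "?L = ?R")
proof -
  define S where "S \<rho> = (\<Sum>(k, l, c)\<in>{..<rep_dim \<rho>} \<times> {..<rep_dim \<rho>} \<times> {..<rbeta (rep_type \<rho>)}.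
        (\<Sum>u<n. qcomp c (rep_mat \<rho> (inv (g u) \<otimes> h u) $$ (k, l)))\<^sup>2)" for \<rho> :: "'g rep"
  have "(\<Sum>x\<in>noise_index n \<rho>. signal_mean n l g \<rho> x * signal_mean n l h \<rho> x / noise_variance \<rho> x)
    = l\<^sup>2 / 2 * (real (rbeta (rep_type \<rho>) * rep_dim \<rho>) / real n * S \<rho>)" if \<rho>: "\<rho> \<in> \<Psi>" for \<rho>
  proof -
    define b where "b = l / real n * sqrt (real (n * rep_dim \<rho>))"
    have mean: "signal_mean n l g \<rho> (i, j, c) = b * qcomp c (gram_entry \<rho> g i j)" for g i j c
      by (simp only: signal_mean_def b_def prod.case)
    have b: "b\<^sup>2 = l\<^sup>2 * real (rep_dim \<rho>) / real n"
      unfolding b_def power_mult_distrib real_sqrt_pow2[OF of_nat_0_le_iff] using n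
      by (simp add: power2_eq_square)
    have "(\<Sum>x\<in>noise_index n \<rho>. signal_mean n l g \<rho> x * signal_mean n l h \<rho> x / noise_variance \<rho> x)
      = (\<Sum>x\<in>noise_index n \<rho>. b\<^sup>2 * ((\<lambda>(i, j, c). qcomp c (gram_entry \<rho> g i j) * qcomp c (gram_entry \<rho> h i j)) x
          / noise_variance \<rho> x))"
      by (intro sum.cong refl) (auto simp: mean power2_eq_square mult_ac)
    also have "\<dots> = b\<^sup>2 * (real (rbeta (rep_type \<rho>)) / 2 * S \<rho>)"
      unfolding sum_distrib_left[symmetric] S_def
      by (subst sum_ensemble_gram[OF rep[OF \<rho>] rep_dim_pos[OF \<rho>] haar_product_carrier[OF g] haar_product_carrier[OF h]]) auto
    finally show ?thesis by (simp add: b mult_ac)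
  qed
  moreover have "(\<Sum>z\<in>Z_index \<Psi>. (\<Sum>u<n. Z_vec (inv (g u) \<otimes> h u) z)\<^sup>2 / real n)
    = (\<Sum>\<rho>\<in>\<Psi>. real (rbeta (rep_type \<rho>) * rep_dim \<rho>) / real n * S \<rho>)"
  proof -
    have "(\<Sum>z\<in>Z_index \<Psi>. (\<Sum>u<n. Z_vec (inv (g u) \<otimes> h u) z)\<^sup>2 / real n) =
      (\<Sum>\<rho>\<in>\<Psi>. \<Sum>x\<in>{..<rep_dim \<rho>} \<times> {..<rep_dim \<rho>} \<times> {..<rbeta (rep_type \<rho>)}.
        (\<Sum>u<n. Z_vec (inv (g u) \<otimes> h u) (\<rho>, x))\<^sup>2 / real n)"
      unfolding Z_index_def by (subst sum.Sigma) (auto simp: finite_freq case_prod_unfold intro!: sum.cong)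
    also have "\<dots> = (\<Sum>\<rho>\<in>\<Psi>. real (rbeta (rep_type \<rho>) * rep_dim \<rho>) / real n * S \<rho>)"
    proof (rule sum.cong[OF refl])
      fix \<rho> :: "'g rep"
      have "(\<Sum>u<n. Z_vec (inv (g u) \<otimes> h u) (\<rho>, x))\<^sup>2 / real n =
        real (rbeta (rep_type \<rho>) * rep_dim \<rho>) / real n *
        (case x of (k, l, c) \<Rightarrow> (\<Sum>u<n. qcomp c (rep_mat \<rho> (inv (g u) \<otimes> h u) $$ (k, l)))\<^sup>2)" for x
      proof -
        obtain k l c where x: "x = (k, l, c)" by (cases x)
        show ?thesis
          unfolding x Z_vec_def prod.case sum_distrib_left[symmetric] power_mult_distrib
            real_sqrt_pow2[OF of_nat_0_le_iff] by simp
      qed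
      then show "(\<Sum>x\<in>{..<rep_dim \<rho>} \<times> {..<rep_dim \<rho>} \<times> {..<rbeta (rep_type \<rho>)}.
          (\<Sum>u<n. Z_vec (inv (g u) \<otimes> h u) (\<rho>, x))\<^sup>2 / real n) =
          real (rbeta (rep_type \<rho>) * rep_dim \<rho>) / real n * S \<rho>"
        unfolding S_def by (simp only: sum_distrib_left)
    qed
    finally show ?thesis .
  qed
  ultimately show ?thesis by (simp add: sum_distrib_left)
qed

text \<open>Here \<open>g\<close> is fixed and only \<open>h\<close> is averaged. The bound depends
  on neither \<open>g\<close> nor \<open>n\<close>: the former is what
  \<open>location_mixture_bound\<close> asks for, the latter what contiguity needs.\<close>

lemma second_moment:
  assumes n: "n > 0" and g: "g \<in> space (haar_product n)" and sub: "sub_gaussian \<mu> (Z_index \<Psi>) Z_vec s"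
  shows "(\<integral>\<^sup>+h. ennreal (exp (\<Sum>\<rho>\<in>\<Psi>. \<Sum>x\<in>noise_index n \<rho>.
      signal_mean n l g \<rho> x * signal_mean n l h \<rho> x / noise_variance \<rho> x)) \<partial>haar_product n)
    \<le> (\<integral>\<^sup>+x. ennreal (exp (l\<^sup>2 * s * x\<^sup>2 / 2)) \<partial>gauss 1) ^ card (Z_index \<Psi>)"
proof -
  have gu: "inv (g u) \<in> carrier G" if "u < n" for u
    using haar_product_carrier[OF g that] by simp
  have "(\<integral>\<^sup>+h. ennreal (exp (\<Sum>\<rho>\<in>\<Psi>. \<Sum>x\<in>noise_index n \<rho>.
      signal_mean n l g \<rho> x * signal_mean n l h \<rho> x / noise_variance \<rho> x)) \<partial>haar_product n)
    = (\<integral>\<^sup>+h. ennreal (exp (l\<^sup>2 / 2 * (\<Sum>z\<in>Z_index \<Psi>. (\<Sum>u<n. Z_vec (inv (g u) \<otimes> h u) z)\<^sup>2 / real n))) \<partial>haar_product n)"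
    by (rule nn_integral_cong) (simp only: sum_signal_mean[OF n g])
  also have "\<dots> \<le> (\<integral>\<^sup>+x. ennreal (exp (l\<^sup>2 * s * x\<^sup>2 / 2)) \<partial>gauss 1) ^ card (Z_index \<Psi>)"
  proof (rule nn_integral_exp_sum_squares[OF prob_space_haar finite_Z_index n])
    fix u k assume "u < n" "k \<in> Z_index \<Psi>"
    then show "(\<lambda>x. Z_vec (inv (g u) \<otimes> x) k) \<in> borel_measurable \<mu>"
      by (rule_tac measurable_compose[OF measurable_translation[OF haar gu] measurable_Z_vec])
  next
    fix u v assume u: "u < n"
    let ?f = "\<lambda>x. ennreal (exp (\<Sum>k\<in>Z_index \<Psi>. Z_vec x k * v k))"
    have f: "?f \<in> borel_measurable \<mu>"
      by (intro measurable_compose[OF _ measurable_ennreal] borel_measurable_exp[THEN measurable_compose[rotated]]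
          borel_measurable_sum borel_measurable_times borel_measurable_const measurable_Z_vec)
    \<comment> \<open>Left invariance removes the fixed translation by \<open>inv (g u)\<close>,
      leaving the integral in the sub-Gaussian hypothesis.\<close>
    have "(\<integral>\<^sup>+x. ?f (inv (g u) \<otimes> x) \<partial>\<mu>) = (\<integral>\<^sup>+x. ?f x \<partial>distr \<mu> \<mu> (\<lambda>x. inv (g u) \<otimes> x))"
      by (rule nn_integral_distr[symmetric, OF measurable_translation[OF haar gu[OF u]]])
         (use f in \<open>simp cong: measurable_cong_sets\<close>)
    also have "\<dots> = (\<integral>\<^sup>+x. ?f x \<partial>\<mu>)" by (simp only: distr_translation[OF haar gu[OF u]])
    also have "\<dots> \<le> ennreal (exp (1/2 * s * (\<Sum>k\<in>Z_index \<Psi>. (v k)\<^sup>2)))"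
      using sub unfolding sub_gaussian_def by blast
    finally show "(\<integral>\<^sup>+x. ?f (inv (g u) \<otimes> x) \<partial>\<mu>) \<le> ennreal (exp (1/2 * s * (\<Sum>k\<in>Z_index \<Psi>. (v k)\<^sup>2)))" .
  qed
  finally show ?thesis .
qed

lemma measurable_signal_mean:
  assumes "\<rho> \<in> \<Psi>" "x \<in> noise_index n \<rho>"
  shows "(\<lambda>g. signal_mean n l g \<rho> x) \<in> borel_measurable (haar_product n)"
proof -
  obtain i j c where x: "x = (i, j, c)" by (cases x)
  with assms(2) have "i < n * rep_dim \<rho>" "j < n * rep_dim \<rho>" by (auto simp: ensemble_index_def)
  from quat_measurable_gram_entry[OF assms(1) this] show ?thesis
    unfolding x signal_mean_def prod.case quat_measurable_def
    by (intro borel_measurable_times borel_measurable_const) blast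
qed

lemma measurable_scaled_noise: "scaled_noise n \<in> measurable (noise n) (obs_space n)"
  unfolding scaled_noise_def[abs_def]
proof (intro measurable_restrict measurable_mat_space)
  fix \<rho> assume \<rho>: "\<rho> \<in> \<Psi>"
  let ?N = "n * rep_dim \<rho>" and ?t = "rep_type \<rho>"
  let ?s = "\<lambda>\<xi>. of_real (1 / sqrt (real ?N)) \<cdot>\<^sub>m hermitian_mat ?t ?N (\<xi> \<rho>)"
  show "?s \<xi> \<in> carrier_mat ?N ?N" for \<xi> by simp
  fix i j assume ij: "i < ?N" "j < ?N"
  have "(\<lambda>\<xi>. \<xi> \<rho>) \<in> measurable (noise n) (ensemble_components ?t ?N)"
    unfolding gauss_product_def ensemble_components_eq using \<rho> by (rule measurable_component_singleton)
  from measurable_compose[OF this measurable_hermitian_mat]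
  have "quat_measurable (noise n) (\<lambda>\<xi>. hermitian_mat ?t ?N (\<xi> \<rho>) $$ (i, j))"
    by (rule quat_measurable_compose[OF mat_space_entry[OF ij]])
  moreover have "qcomp c (?s \<xi> $$ (i, j)) = 1 / sqrt (real ?N) * qcomp c (hermitian_mat ?t ?N (\<xi> \<rho>) $$ (i, j))" for c \<xi>
    using qcomp_scaled_noise[OF \<rho> ij, of c \<xi>] \<rho> by (simp only: scaled_noise_def restrict_apply if_True)
  ultimately show "quat_measurable (noise n) (\<lambda>\<xi>. ?s \<xi> $$ (i, j))"
    unfolding quat_measurable_def by (simp only:) (intro allI borel_measurable_times borel_measurable_const, blast)
qed

section \<open>Events of the model pulled back to the noise space\<close>

lemma GSynch_eq_shifted:
  assumes n: "n > 0"
  shows "GSynch n (\<lambda>_. l) \<mu> \<Psi> = distr (haar_product n \<Otimes>\<^sub>M noise n) (obs_space n)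
    (\<lambda>(g, \<xi>). scaled_noise n (location_shift \<Psi> (noise_index n) (signal_mean n l g) \<xi>))"
  unfolding GSynch_eq
  by (rule distr_cong) (auto simp: space_pair_measure observation_eq_scaled_noise[OF n])

text \<open>The right-hand side is the left-hand side of \<open>location_mixture_bound\<close> with
  \<open>B\<close> the pulled-back event.\<close>

lemma emeasure_GSynch:
  assumes n: "n > 0" and A: "A \<in> sets (obs_space n)"
  shows "emeasure (GSynch n (\<lambda>_. l) \<mu> \<Psi>) A = emeasure (haar_product n \<Otimes>\<^sub>M noise n)
    ((\<lambda>(g, \<xi>). location_shift \<Psi> (noise_index n) (signal_mean n l g) \<xi>) -` (scaled_noise n -` A \<inter> space (noise n))
      \<inter> space (haar_product n \<Otimes>\<^sub>M noise n))"
proof -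
  have S: "(\<lambda>z. location_shift \<Psi> (noise_index n) (signal_mean n l (fst z)) (snd z))
      \<in> measurable (haar_product n \<Otimes>\<^sub>M noise n) (noise n)"
    by (intro noise.measurable_location_shift measurable_compose[OF measurable_fst measurable_signal_mean] measurable_snd)
  show ?thesis
    unfolding GSynch_eq_shifted[OF n] case_prod_unfold
    by (subst emeasure_distr[OF measurable_compose[OF S measurable_scaled_noise] A])
       (use measurable_space[OF S] in \<open>auto intro!: arg_cong2[where f=emeasure]\<close>)
qed

text \<open>At \<open>l = 0\<close> the mean vanishes, so the shift fixes every point of the noise
  space, points being extensional. The event then does not involve the group elements, which
  contribute total mass 1.\<close>

lemma emeasure_GSynch_0:
  assumes n: "n > 0" and A: "A \<in> sets (obs_space n)"
  shows "emeasure (GSynch n (\<lambda>_. 0) \<mu> \<Psi>) A = emeasure (noise n) (scaled_noise n -` A \<inter> space (noise n))"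
proof -
  interpret h: prob_space "haar_product n" by (rule prob_space_haar_product)
  interpret N: prob_space "noise n" by (rule noise.prob_space_N)
  have "location_shift \<Psi> (noise_index n) (signal_mean n 0 g) \<xi> = \<xi>" if "\<xi> \<in> space (noise n)" for g \<xi>
    using that by (auto simp: gauss_product_def space_PiM location_shift_def signal_mean_def fun_eq_iff
        PiE_iff extensional_def restrict_def)
  then have "(\<lambda>(g, \<xi>). location_shift \<Psi> (noise_index n) (signal_mean n 0 g) \<xi>) -` (scaled_noise n -` A \<inter> space (noise n))
      \<inter> space (haar_product n \<Otimes>\<^sub>M noise n) = space (haar_product n) \<times> (scaled_noise n -` A \<inter> space (noise n))"
    by (auto simp: space_pair_measure)
  then show ?thesis
    unfolding emeasure_GSynch[OF n A] using measurable_sets[OF measurable_scaled_noise A]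
    by (simp add: N.emeasure_pair_measure_Times h.emeasure_space_1)
qed

end

section \<open>From a uniform second moment bound to contiguity\<close>

text \<open>First choose \<open>c\<close> so large that \<open>K / c\<close> is small, uniformly in
  \<open>n\<close>; then let \<open>n\<close> grow until \<open>c\<close> times the probability
  under \<open>Q\<close> is small.\<close>

lemma contiguous_of_affine_bounds:
  assumes P: "\<And>n. prob_space (P n)" and Q: "\<And>n. prob_space (Q n)"
    and "\<And>n. space (P n) = space (Q n)" "\<And>n. sets (P n) = sets (Q n)"
    and K: "K < \<infinity>"
    and bound: "\<And>n A c. n > 0 \<Longrightarrow> A \<in> sets (Q n) \<Longrightarrow> c > 0 \<Longrightarrow>
      emeasure (P n) A \<le> ennreal c * emeasure (Q n) A + K / ennreal c"
  shows "contiguous P Q"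
  unfolding contiguous_def
proof (intro conjI allI impI)
  fix A assume A: "\<forall>n. A n \<in> sets (Q n)" and lim: "(\<lambda>n. measure (Q n) (A n)) \<longlonglongrightarrow> 0"
  define k where "k = enn2real K"
  have k: "K = ennreal k" "k \<ge> 0" using K by (simp_all add: k_def)
  have b: "measure (P n) (A n) \<le> c * measure (Q n) (A n) + k / c" if "n > 0" "c > 0" for n c
  proof -
    interpret p: prob_space "P n" by (rule P)
    interpret q: prob_space "Q n" by (rule Q)
    have "emeasure (P n) (A n) \<le> ennreal c * emeasure (Q n) (A n) + K / ennreal c"
      using A by (intro bound that) blast
    also have "\<dots> = ennreal (c * measure (Q n) (A n)) + ennreal (k / c)"
      using that k by (simp only: q.emeasure_eq_measure ennreal_mult'[OF less_imp_le[OF that(2)]] divide_ennreal)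
    also have "\<dots> = ennreal (c * measure (Q n) (A n) + k / c)"
      using that k by (intro ennreal_plus[symmetric]) auto
    finally have "ennreal (measure (P n) (A n)) \<le> ennreal (c * measure (Q n) (A n) + k / c)"
      by (simp only: p.emeasure_eq_measure)
    moreover have "0 \<le> c * measure (Q n) (A n) + k / c"
      using that k by (intro add_nonneg_nonneg) auto
    ultimately show ?thesis by (simp only: ennreal_le_iff)
  qed
  show "(\<lambda>n. measure (P n) (A n)) \<longlonglongrightarrow> 0"
  proof (rule LIMSEQ_I)
    fix r :: real assume r: "r > 0"
    \<comment> \<open>Using \<open>k + 1\<close> instead of \<open>k\<close> keeps \<open>c\<close>
      positive when \<open>k = 0\<close> and makes \<open>k / c < r / 2\<close> strict.\<close>
    define c where "c = 2 * (k + 1) / r"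
    have c: "c > 0" "k / c < r / 2" using r k by (auto simp: c_def field_simps)
    from LIMSEQ_D[OF lim, of "r / 2 / c"] r c obtain n0 where
      n0: "\<And>n. n \<ge> n0 \<Longrightarrow> measure (Q n) (A n) < r / 2 / c" by auto
    \<comment> \<open>The maximum with 1 excludes \<open>n = 0\<close>, for which no bound is
      assumed.\<close>
    show "\<exists>no. \<forall>n\<ge>no. norm (measure (P n) (A n) - 0) < r"
    proof (intro exI[of _ "max n0 1"] allI impI)
      fix n assume "max n0 1 \<le> n"
      then have *: "c * measure (Q n) (A n) < r / 2" "n > 0"
        using n0[of n] c by (auto simp: field_simps)
      have "measure (P n) (A n) < r" using b[OF *(2) c(1)] *(1) c(2) by linarith
      then show "norm (measure (P n) (A n) - 0) < r" by simp
    qed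
  qed
qed (use assms in auto)

theorem theorem6p10:
  fixes G :: "('g, 'm) monoid_scheme" and T :: "'g topology" and \<mu> :: "'g measure"
    and \<Psi> :: "'g rep set" and lam \<sigma> :: real
  assumes "compact_group G T"
    and "haar_measure G T \<mu>"
    and "frequency_list G T \<Psi>"
    and "lam \<ge> 0"
    and "\<sigma> > 0"
    and "sub_gaussian \<mu> (Z_index \<Psi>) Z_vec (\<sigma>\<^sup>2)"
    and "lam < 1 / \<sigma>"
  shows "contiguous (\<lambda>n. GSynch n (\<lambda>_. lam) \<mu> \<Psi>) (\<lambda>n. GSynch n (\<lambda>_. 0) \<mu> \<Psi>)"
proof -
  \<comment> \<open>Positivity of the dimension is part of irreducibility, stated there for the
    complex dimension \<open>cdim\<close>.\<close>
  have rep: "unitary_rep G T \<rho>" "rep_dim \<rho> > 0" if "\<rho> \<in> \<Psi>" for \<rho>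
    using assms(3) that
    by (auto simp: frequency_list_def irrep_def irreducible_rep_def cdim_def split: if_splits)
  interpret synchronization G T \<mu> \<Psi>
    using assms(1-3) rep
    by (simp add: synchronization_def synchronization_axioms_def frequency_list_def)
  have "lam * \<sigma> < 1" using assms(5,7) by (simp add: field_simps)
  then have "(lam * \<sigma>)\<^sup>2 < 1"
    using assms(4,5) by (simp add: abs_square_less_1)
  then have "lam\<^sup>2 * \<sigma>\<^sup>2 < 1" by (simp add: power_mult_distrib)
  define K where "K = (\<integral>\<^sup>+x. ennreal (exp (lam\<^sup>2 * \<sigma>\<^sup>2 * x\<^sup>2 / 2)) \<partial>gauss 1) ^ card (Z_index \<Psi>)"
  show ?thesis
  proof (rule contiguous_of_affine_bounds[where K = K])
    show "K < \<infinity>"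
      using nn_integral_gauss_exp_square[OF \<open>lam\<^sup>2 * \<sigma>\<^sup>2 < 1\<close>]
      by (simp add: K_def power_less_top_ennreal)
  next
    fix n :: nat and A and c :: real
    assume n: "n > 0" and "A \<in> sets (GSynch n (\<lambda>_. 0) \<mu> \<Psi>)" and c: "c > 0"
    then have A: "A \<in> sets (obs_space n)" by (simp add: GSynch_def)
    show "emeasure (GSynch n (\<lambda>_. lam) \<mu> \<Psi>) A \<le> ennreal c * emeasure (GSynch n (\<lambda>_. 0) \<mu> \<Psi>) A + K / ennreal c"
      \<comment> \<open>The zero-signal side is rewritten first, since
        \<open>emeasure_GSynch\<close> with free \<open>l\<close> would match it too.\<close>
      unfolding emeasure_GSynch_0[OF n A] unfolding emeasure_GSynch[OF n A]
      by (rule noise.location_mixture_bound[OF prob_space_haar_product measurable_signal_mean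
            measurable_sets[OF measurable_scaled_noise A] c])
         (simp_all only: K_def second_moment[OF n _ assms(6)])
  qed (simp_all only: prob_space_GSynch, simp_all add: GSynch_def)
qed

end
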